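(* Let $\mathfrak k$ be a commutative domain and $n\ge 1$. Let $A=\mathfrak k\langle x_1,\dots,x_n\rangle$ be the free associative algebra with augmentation ideal $\bar A=\sum_{i=1}^nAx_i$, let $\Lambda=\mathfrak kF$ be the group algebra of the free group $F$ on $t_1=x_1+1,\dots,t_n=x_n+1$ with augmentation ideal $\bar\Lambda=\sum_{i=1}^n\Lambda x_i$ (where $x_i=t_i-1$), and let $\Gamma=\mathfrak k\langle\langle x_1,\dots,x_n\rangle\rangle$ be the completion of $A$ in the $\bar A$-adic topology, which contains $\Lambda$ via $t_i\mapsto 1+x_i$. Then the rational closure $A^{\rm rat}_{\bar A}$ of $A$ in $\Gamma$ is both the universal Cohn localization of $A$ inverting $1+M_{\bar A}$ and the universal Cohn localization of $\Lambda$ inverting $1+M_{\bar\Lambda}$ (in both cases via the inclusion map).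
   Context: All algebras are unital associative $\mathfrak k$-algebras. $\Gamma$ is the algebra of formal power series in the non-commuting variables $x_1,\dots,x_n$ over $\mathfrak k$. Every power series $r$ with zero constant term has a quasi-inverse $r^+=\sum_{m\ge1}r^m$ in $\Gamma$; the rational closure $A^{\rm rat}_{\bar A}$ is the smallest subalgebra of $\Gamma$ containing $A$ and closed under taking quasi-inverses of its elements with zero constant term (it contains $\Lambda$). For an ideal $I$ of an algebra $R$, $M_I=\bigcup_{l\ge1}M_l(I)$ is the set of all square matrices (of all sizes) with entries in $I$, and $1+M_I$ is the set of matrices $1+Q$ with $Q\in M_I$ and $1$ the identity matrix of the same size. For a set $\Sigma$ of square matrices over $R$, a homomorphism $f\colon R\to S$ is $\Sigma$-inverting if every matrix in $\Sigma$ becomes invertible over $S$ under $f$; the universal Cohn localization of $R$ inverting $\Sigma$ is a $\Sigma$-inverting homomorphism $\jmath\colon R\to R_\Sigma$ such that every $\Sigma$-inverting homomorphism $f\colon R\to S$ factors as $f=g\jmath$ for a unique algebra homomorphism $g\colon R_\Sigma\to S$. *)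

theory Defs
  imports "HOL-Library.Poly_Mapping" "Jordan_Normal_Form.Matrix"
begin

section \<open>Algebras and universal localization\<close>

text \<open>The sort \<open>{ring, monoid_mult}\<close> is that of unital associative rings; unlike \<^class>\<open>ring_1\<close> it
  does not exclude the zero ring.\<close>

locale unital_algebra = Modules.module scale
  for scale :: "'k::comm_ring_1 \<Rightarrow> 'r::{ring,monoid_mult} \<Rightarrow> 'r" +
  assumes scale_mult_left: "scale a x * y = scale a (x * y)"
    and scale_mult_right: "x * scale a y = scale a (x * y)"

locale algebra_hom =
  R: unital_algebra sR + S: unital_algebra sS + Modules.module_hom sR sS f
  for sR :: "'k::comm_ring_1 \<Rightarrow> 'r::{ring,monoid_mult} \<Rightarrow> 'r"
    and sS :: "'k \<Rightarrow> 's::{ring,monoid_mult} \<Rightarrow> 's"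
    and f :: "'r \<Rightarrow> 's" +
  assumes mult: "f (x * y) = f x * f y"
    and one: "f 1 = 1"

definition unital_subalgebra :: "('k::comm_ring_1 \<Rightarrow> 'r::{ring,monoid_mult} \<Rightarrow> 'r) \<Rightarrow> 'r set \<Rightarrow> bool" where
  "unital_subalgebra scale B \<longleftrightarrow> 1 \<in> B \<and> (\<forall>x\<in>B. \<forall>y\<in>B. x + y \<in> B \<and> x * y \<in> B) \<and> (\<forall>a. \<forall>x\<in>B. scale a x \<in> B)"

text \<open>This is \<^const>\<open>invertible_mat\<close>, whose type requires \<open>0 \<noteq> 1\<close>, over possibly zero rings.\<close>

definition invertible_matrix :: "'r::{ring,monoid_mult} mat \<Rightarrow> bool" where
  "invertible_matrix M \<longleftrightarrow> square_mat M \<and>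
     (\<exists>N. M * N = 1\<^sub>m (dim_row M) \<and> N * M = 1\<^sub>m (dim_row N))"

definition inverting :: "'r mat set \<Rightarrow> ('r \<Rightarrow> 's::{ring,monoid_mult}) \<Rightarrow> bool" where
  "inverting \<Sigma> f \<longleftrightarrow> (\<forall>M\<in>\<Sigma>. invertible_matrix (map_mat f M))"

text \<open>The first argument is the type over which the carriers of the test algebras range; a theorem
  with a free type variable in that place speaks about all test algebras.\<close>

definition universal_localization ::
    "'s::{ring,monoid_mult} itself \<Rightarrow>
     ('k::comm_ring_1 \<Rightarrow> 'r::{ring,monoid_mult} \<Rightarrow> 'r) \<Rightarrow> ('k \<Rightarrow> 'u::{ring,monoid_mult} \<Rightarrow> 'u) \<Rightarrow>
     'r mat set \<Rightarrow> ('r \<Rightarrow> 'u) \<Rightarrow> bool" where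
  "universal_localization _ sR sU \<Sigma> j \<longleftrightarrow>
     algebra_hom sR sU j \<and> inverting \<Sigma> j \<and>
     (\<forall>(sS :: 'k \<Rightarrow> 's \<Rightarrow> 's) f. algebra_hom sR sS f \<and> inverting \<Sigma> f \<longrightarrow>
        (\<exists>!g. algebra_hom sU sS g \<and> f = g \<circ> j))"

definition one_plus_matrices :: "'r::{ring,monoid_mult} set \<Rightarrow> 'r mat set" where
  "one_plus_matrices I = {1\<^sub>m l + Q | l Q. 1 \<le> l \<and> Q \<in> carrier_mat l l \<and> elements_mat Q \<subseteq> I}"

definition left_span :: "('n::finite \<Rightarrow> 'r::ring) \<Rightarrow> 'r set" where
  "left_span x = {\<Sum>i\<in>UNIV. a i * x i | a. True}"


section \<open>The free algebra\<close>

text \<open>In the type \<open>'a \<Rightarrow>\<^sub>0 'k\<close>, multiplication is convolution over the (additively written) monoid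
  \<open>'a\<close>, which need not be commutative; it is thus the monoid algebra of \<open>'a\<close>. The finite type
  \<open>'n\<close> indexes the variables.\<close>

datatype 'n free_monoid = Word (letters: "'n list")

instantiation free_monoid :: (type) monoid_add
begin
definition zero_free_monoid :: "'a free_monoid" where "0 = Word []"
definition plus_free_monoid :: "'a free_monoid \<Rightarrow> 'a free_monoid \<Rightarrow> 'a free_monoid" where
  "u + v = Word (letters u @ letters v)"
instance
  by standard (auto simp: zero_free_monoid_def plus_free_monoid_def)
end

definition pm_scale :: "'k::comm_ring_1 \<Rightarrow> ('a \<Rightarrow>\<^sub>0 'k) \<Rightarrow> ('a \<Rightarrow>\<^sub>0 'k)" where
  "pm_scale c = Poly_Mapping.map ((*) c)"

type_synonym ('k, 'n) free_algebra = "'n free_monoid \<Rightarrow>\<^sub>0 'k"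

definition fa_var :: "'n \<Rightarrow> ('k::comm_ring_1, 'n) free_algebra" where
  "fa_var i = Poly_Mapping.single (Word [i]) 1"

definition fa_aug :: "('k::comm_ring_1, 'n::finite) free_algebra set" where
  "fa_aug = left_span fa_var"


section \<open>The group algebra of the free group\<close>

text \<open>Elements of the free group are reduced words in the letters \<open>(i, True)\<close>, for the generator
  \<open>t\<^sub>i\<close>, and \<open>(i, False)\<close>, for its inverse. The group is written additively to fit
  \<^class>\<open>monoid_add\<close>.\<close>

definition inv_letter :: "'n \<times> bool \<Rightarrow> 'n \<times> bool" where
  "inv_letter x = (fst x, \<not> snd x)"

definition reduced :: "('n \<times> bool) list \<Rightarrow> bool" where
  "reduced = successively (\<lambda>x y. y \<noteq> inv_letter x)"

fun reduced_Cons :: "'n \<times> bool \<Rightarrow> ('n \<times> bool) list \<Rightarrow> ('n \<times> bool) list" where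
  "reduced_Cons x [] = [x]"
| "reduced_Cons x (y # w) = (if y = inv_letter x then w else x # y # w)"

definition reduced_append :: "('n \<times> bool) list \<Rightarrow> ('n \<times> bool) list \<Rightarrow> ('n \<times> bool) list" where
  "reduced_append u v = foldr reduced_Cons u v"

lemma inv_letter_inv_letter [simp]: "inv_letter (inv_letter x) = x"
  by (simp add: inv_letter_def)

lemma reduced_Nil: "reduced []"
  by (simp add: reduced_def)

lemma reduced_ConsD: "reduced (x # w) \<Longrightarrow> reduced w"
  by (cases w) (auto simp: reduced_def)

lemma reduced_reduced_Cons: "reduced w \<Longrightarrow> reduced (reduced_Cons x w)"
  by (cases w) (auto simp: reduced_def dest: reduced_ConsD[unfolded reduced_def])

lemma reduced_reduced_append: "reduced v \<Longrightarrow> reduced (reduced_append u v)"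
  by (induction u) (auto simp: reduced_append_def intro: reduced_reduced_Cons)

lemma reduced_Cons_inv_letter: "reduced w \<Longrightarrow> reduced_Cons (inv_letter x) (reduced_Cons x w) = w"
  by (cases w rule: list.exhaust[case_names Nil Cons]; cases "tl w")
     (auto simp: reduced_def)

lemma reduced_append_Cons:
  assumes "reduced v" "reduced w"
  shows "reduced_append (reduced_Cons x v) w = reduced_Cons x (reduced_append v w)"
proof (cases v)
  case (Cons y ys)
  then show ?thesis
    using reduced_Cons_inv_letter[OF reduced_reduced_append[OF \<open>reduced w\<close>], of y ys] 
      reduced_Cons_inv_letter[OF reduced_reduced_append[OF \<open>reduced w\<close>], of "inv_letter x" ys] 
    by (auto simp: reduced_append_def)
qed (simp add: reduced_append_def)

lemma reduced_append_assoc: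
  assumes "reduced v" "reduced w"
  shows "reduced_append (reduced_append u v) w = reduced_append u (reduced_append v w)"
proof (induction u)
  case (Cons x u)
  have "reduced_append (x # u) y = reduced_Cons x (reduced_append u y)" for y
    by (simp add: reduced_append_def)
  then show ?case
    using Cons reduced_append_Cons[OF reduced_reduced_append[OF assms(1)] assms(2)] by metis
qed (simp add: reduced_append_def)

lemma reduced_append_Nil: "reduced u \<Longrightarrow> reduced_append u [] = u"
proof (induction u)
  case (Cons x u)
  then show ?case
    by (cases u) (auto simp: reduced_append_def reduced_def)
qed (simp add: reduced_append_def)

lemma reduced_append_inverse:
  "reduced w \<Longrightarrow> reduced_append (rev (map inv_letter u)) (reduced_append u w) = w"
proof (induction u)
  case (Cons x u)
  then show ?case
    using reduced_Cons_inv_letter[OF reduced_reduced_append[OF Cons.prems], of x u]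
    by (simp add: reduced_append_def)
qed (simp add: reduced_append_def)

lemma reduced_inverse: "reduced u \<Longrightarrow> reduced (rev (map inv_letter u))"
  unfolding reduced_def successively_rev successively_map
  by (erule successively_mono) (auto simp: inv_letter_def)

typedef 'n free_group = "{w :: ('n \<times> bool) list. reduced w}"
  morphisms reduced_word Abs_free_group
  using reduced_Nil by blast

setup_lifting type_definition_free_group

instantiation free_group :: (type) group_add
begin

lift_definition zero_free_group :: "'a free_group" is "[]"
  by (rule reduced_Nil)

lift_definition plus_free_group :: "'a free_group \<Rightarrow> 'a free_group \<Rightarrow> 'a free_group"
  is reduced_append
  by (rule reduced_reduced_append)

lift_definition uminus_free_group :: "'a free_group \<Rightarrow> 'a free_group"
  is "\<lambda>u. rev (map inv_letter u)"
  by (rule reduced_inverse)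

definition minus_free_group :: "'a free_group \<Rightarrow> 'a free_group \<Rightarrow> 'a free_group" where
  "u - v = u + - (v :: 'a free_group)"

instance
proof
  fix a b c :: "'a free_group"
  show "a + b + c = a + (b + c)"
    by transfer (rule reduced_append_assoc)
  show "0 + a = a"
    by transfer (simp add: reduced_append_def)
  show "a + 0 = a"
    by transfer (rule reduced_append_Nil)
  show "- a + a = 0"
    by transfer (metis reduced_Nil reduced_append_Nil reduced_append_inverse)
  show "a + - b = a - b"
    by (simp add: minus_free_group_def)
qed

end

lift_definition fg_gen :: "'n \<Rightarrow> 'n free_group" is "\<lambda>i. [(i, True)]"
  by (simp add: reduced_def)

type_synonym ('k, 'n) free_group_algebra = "'n free_group \<Rightarrow>\<^sub>0 'k"

definition fga_var :: "'n \<Rightarrow> ('k::comm_ring_1, 'n) free_group_algebra" where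
  "fga_var i = Poly_Mapping.single (fg_gen i) 1 - 1"

definition fga_aug :: "('k::comm_ring_1, 'n::finite) free_group_algebra set" where
  "fga_aug = left_span fga_var"


section \<open>Non-commutative formal power series\<close>

typedef ('k, 'n) ncfps = "UNIV :: ('n list \<Rightarrow> 'k) set"
  morphisms nc_coeff Abs_ncfps
  by simp

setup_lifting type_definition_ncfps

lemma ncfps_eqI: "(\<And>w. nc_coeff f w = nc_coeff g w) \<Longrightarrow> f = g"
  by transfer auto

instantiation ncfps :: (comm_ring_1, type) ring_1
begin

lift_definition zero_ncfps :: "('a, 'b) ncfps" is "\<lambda>_. 0" .

lift_definition one_ncfps :: "('a, 'b) ncfps" is "\<lambda>w. if w = [] then 1 else 0" .

lift_definition plus_ncfps :: "('a, 'b) ncfps \<Rightarrow> ('a, 'b) ncfps \<Rightarrow> ('a, 'b) ncfps"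
  is "\<lambda>f g w. f w + g w" .

lift_definition minus_ncfps :: "('a, 'b) ncfps \<Rightarrow> ('a, 'b) ncfps \<Rightarrow> ('a, 'b) ncfps"
  is "\<lambda>f g w. f w - g w" .

lift_definition uminus_ncfps :: "('a, 'b) ncfps \<Rightarrow> ('a, 'b) ncfps"
  is "\<lambda>f w. - f w" .

lift_definition times_ncfps :: "('a, 'b) ncfps \<Rightarrow> ('a, 'b) ncfps \<Rightarrow> ('a, 'b) ncfps"
  is "\<lambda>f g w. \<Sum>i\<le>length w. f (take i w) * g (drop i w)" .

instance
proof
  fix a b c :: "('a, 'b) ncfps"
  show "a * b * c = a * (b * c)"
  proof transfer
    fix f g h :: "'b list \<Rightarrow> 'a"
    show "(\<lambda>w. \<Sum>i\<le>length w. (\<Sum>j\<le>length (take i w). f (take j (take i w)) * g (drop j (take i w)))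
              * h (drop i w)) =
          (\<lambda>w. \<Sum>j\<le>length w. f (take j w) *
              (\<Sum>m\<le>length (drop j w). g (take m (drop j w)) * h (drop m (drop j w))))"
    proof
      fix w :: "'b list"
      define n where "n = length w"
      define G where "G j m = f (take j w) * g (take m (drop j w)) * h (drop (m + j) w)" for j m
      have "(\<Sum>i\<le>length w. (\<Sum>j\<le>length (take i w). f (take j (take i w)) * g (drop j (take i w)))
              * h (drop i w)) = (\<Sum>i\<le>n. \<Sum>j\<le>i. G j (i - j))"
        by (auto simp: n_def G_def sum_distrib_right drop_take min_def intro!: sum.cong)
      also have "\<dots> = (\<Sum>(j, m)\<in>{(j, m). j + m \<le> n}. G j m)"
        by (rule sum.triangle_reindex_eq[symmetric])
      also have "{(j, m). j + m \<le> n} = (SIGMA j:{..n}. {..n - j})"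
        by auto
      also have "(\<Sum>(j, m)\<in>(SIGMA j:{..n}. {..n - j}). G j m) = (\<Sum>j\<le>n. \<Sum>m\<le>n - j. G j m)"
        by (rule sum.Sigma[symmetric]) auto
      also have "\<dots> = (\<Sum>j\<le>length w. f (take j w) *
              (\<Sum>m\<le>length (drop j w). g (take m (drop j w)) * h (drop m (drop j w))))"
        by (auto simp: n_def G_def sum_distrib_left mult.assoc intro!: sum.cong)
      finally show "(\<Sum>i\<le>length w. (\<Sum>j\<le>length (take i w). f (take j (take i w)) * g (drop j (take i w)))
              * h (drop i w)) = (\<Sum>j\<le>length w. f (take j w) *
              (\<Sum>m\<le>length (drop j w). g (take m (drop j w)) * h (drop m (drop j w))))" .
    qed
  qed
  show "1 * a = a"
  proof transfer
    fix f :: "'b list \<Rightarrow> 'a"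
    show "(\<lambda>w. \<Sum>i\<le>length w. (if take i w = [] then 1 else 0) * f (drop i w)) = f"
    proof
      fix w :: "'b list"
      have "(\<Sum>i\<le>length w. (if take i w = [] then 1 else 0) * f (drop i w)) =
            (\<Sum>i\<le>length w. if i = 0 then f w else 0)"
        by (rule sum.cong) (cases "w = []"; auto)+
      then show "(\<Sum>i\<le>length w. (if take i w = [] then 1 else 0) * f (drop i w)) = f w"
        by simp
    qed
  qed
  show "a * 1 = a"
  proof transfer
    fix f :: "'b list \<Rightarrow> 'a"
    show "(\<lambda>w. \<Sum>i\<le>length w. f (take i w) * (if drop i w = [] then 1 else 0)) = f"
    proof
      fix w :: "'b list"
      have "(\<Sum>i\<le>length w. f (take i w) * (if drop i w = [] then 1 else 0)) =
            (\<Sum>i\<le>length w. if i = length w then f w else 0)"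
        by (rule sum.cong) auto
      then show "(\<Sum>i\<le>length w. f (take i w) * (if drop i w = [] then 1 else 0)) = f w"
        by simp
    qed
  qed
  show "a + b + c = a + (b + c)" "a + b = b + a" "0 + a = a" "- a + a = 0" "a - b = a + - b"
    by (transfer; simp add: algebra_simps)+
  show "(a + b) * c = a * c + b * c" "a * (b + c) = a * b + a * c"
    by (transfer; simp add: algebra_simps sum.distrib)+
  show "(0 :: ('a, 'b) ncfps) \<noteq> 1"
    by transfer (metis zero_neq_one)
qed

end

lift_definition nc_scale :: "'k::comm_ring_1 \<Rightarrow> ('k, 'n) ncfps \<Rightarrow> ('k, 'n) ncfps"
  is "\<lambda>c f w. c * f w" .

lift_definition nc_var :: "'n \<Rightarrow> ('k::comm_ring_1, 'n) ncfps"
  is "\<lambda>i w. if w = [i] then 1 else 0" .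

text \<open>The quasi-inverse \<open>\<Sum>m\<ge>1. r ^ m\<close> of a series \<open>r\<close> with zero constant term. The coefficient of
  \<open>r ^ m\<close> at \<open>w\<close> vanishes for \<open>m > length w\<close>, see \<open>nc_coeff_power_eq_0\<close> below.\<close>

definition quasi_inverse :: "('k::comm_ring_1, 'n) ncfps \<Rightarrow> ('k, 'n) ncfps" where
  "quasi_inverse r = Abs_ncfps (\<lambda>w. \<Sum>m = 1..length w. nc_coeff (r ^ m) w)"

lemma nc_coeff_quasi_inverse:
  "nc_coeff (quasi_inverse r) w = (\<Sum>m = 1..length w. nc_coeff (r ^ m) w)"
  by (simp add: quasi_inverse_def Abs_ncfps_inverse)

lemma nc_coeff_power_eq_0:
  assumes "nc_coeff r [] = 0" "length w < m"
  shows "nc_coeff (r ^ m) w = 0"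
  using assms(2)
proof (induction m arbitrary: w)
  case (Suc m)
  have "nc_coeff r (take i w) * nc_coeff (r ^ m) (drop i w) = 0" if "i \<le> length w" for i
  proof (cases "i = 0")
    case False
    then have "length (drop i w) < m"
      using that Suc.prems by simp
    then show ?thesis
      using Suc.IH by simp
  qed (simp add: assms(1))
  then show ?case
    by (simp add: times_ncfps.rep_eq)
qed simp

lemma quasi_inverse_unfold:
  fixes r :: "('k::comm_ring_1, 'n) ncfps"
  assumes "nc_coeff r [] = 0"
  shows "quasi_inverse r = r + r * quasi_inverse r"
proof (rule ncfps_eqI)
  fix w :: "'n list"
  let ?n = "length w"
  have "nc_coeff (r * quasi_inverse r) w = 
      (\<Sum>i\<le>?n. \<Sum>m = 1..?n. nc_coeff r (take i w) * nc_coeff (r ^ m) (drop i w))"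
    unfolding times_ncfps.rep_eq nc_coeff_quasi_inverse sum_distrib_left
    using nc_coeff_power_eq_0[OF assms]
    by (intro sum.cong[OF refl] sum.mono_neutral_left) auto
  also have "\<dots> = (\<Sum>m = 1..?n. nc_coeff (r ^ Suc m) w)"
    by (subst sum.swap) (simp add: times_ncfps.rep_eq)
  also have "\<dots> = (\<Sum>m = Suc 1..Suc ?n. nc_coeff (r ^ m) w)"
    by (rule sum.shift_bounds_cl_Suc_ivl[symmetric])
  finally have "nc_coeff (r + r * quasi_inverse r) w =
      nc_coeff (r ^ 1) w + (\<Sum>m = Suc 1..Suc ?n. nc_coeff (r ^ m) w)"
    by (simp add: plus_ncfps.rep_eq)
  also have "\<dots> = (\<Sum>m = 1..Suc ?n. nc_coeff (r ^ m) w)"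
    by (subst (2) sum.atLeast_Suc_atMost) simp_all
  also have "\<dots> = nc_coeff (quasi_inverse r) w"
    using nc_coeff_power_eq_0[OF assms, of w "Suc ?n"] by (simp add: nc_coeff_quasi_inverse)
  finally show "nc_coeff (quasi_inverse r) w = nc_coeff (r + r * quasi_inverse r) w"
    by simp
qed


section \<open>The free algebra and the free group algebra inside the power series\<close>

definition fa_to_nc :: "('k::comm_ring_1, 'n) free_algebra \<Rightarrow> ('k, 'n) ncfps" where
  "fa_to_nc p = Abs_ncfps (\<lambda>w. Poly_Mapping.lookup p (Word w))"

text \<open>\<open>t\<^sub>i\<close> is sent to \<open>1 + x\<^sub>i\<close>, hence its inverse to \<open>1 + (- x\<^sub>i)\<^sup>+\<close>.\<close>

definition letter_to_nc :: "'n \<times> bool \<Rightarrow> ('k::comm_ring_1, 'n) ncfps" where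
  "letter_to_nc x =
     (if snd x then 1 + nc_var (fst x) else 1 + quasi_inverse (- nc_var (fst x)))"

definition fg_to_nc :: "'n free_group \<Rightarrow> ('k::comm_ring_1, 'n) ncfps" where
  "fg_to_nc g = prod_list (map letter_to_nc (reduced_word g))"

definition fga_to_nc :: "('k::comm_ring_1, 'n) free_group_algebra \<Rightarrow> ('k, 'n) ncfps" where
  "fga_to_nc p = (\<Sum>g\<in>Poly_Mapping.keys p. nc_scale (Poly_Mapping.lookup p g) (fg_to_nc g))"

section \<open>The rational closure\<close>

definition rational_closure :: "('k::comm_ring_1, 'n) ncfps set" where
  "rational_closure = \<Inter> {B. unital_subalgebra nc_scale B \<and> range fa_to_nc \<subseteq> B \<and>
     (\<forall>r\<in>B. nc_coeff r [] = 0 \<longrightarrow> quasi_inverse r \<in> B)}"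

lemma rational_closure_fa: "fa_to_nc p \<in> rational_closure"
  by (auto simp: rational_closure_def)

lemma rational_closure_one: "1 \<in> rational_closure"
  by (auto simp: rational_closure_def unital_subalgebra_def)

lemma rational_closure_add:
  "x \<in> rational_closure \<Longrightarrow> y \<in> rational_closure \<Longrightarrow> x + y \<in> rational_closure"
  by (auto simp: rational_closure_def unital_subalgebra_def)

lemma rational_closure_mult:
  "x \<in> rational_closure \<Longrightarrow> y \<in> rational_closure \<Longrightarrow> x * y \<in> rational_closure"
  by (auto simp: rational_closure_def unital_subalgebra_def)

lemma rational_closure_scale: "x \<in> rational_closure \<Longrightarrow> nc_scale c x \<in> rational_closure"
  by (auto simp: rational_closure_def unital_subalgebra_def)

lemma rational_closure_quasi_inverse:
  "x \<in> rational_closure \<Longrightarrow> nc_coeff x [] = 0 \<Longrightarrow> quasi_inverse x \<in> rational_closure"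
  by (auto simp: rational_closure_def)

lemma rational_closure_zero: "0 \<in> rational_closure"
proof -
  have "nc_scale 0 1 = (0 :: ('k::comm_ring_1, 'n) ncfps)"
    by transfer auto
  then show ?thesis
    using rational_closure_scale[OF rational_closure_one] by metis
qed

lemma rational_closure_uminus: "x \<in> rational_closure \<Longrightarrow> - x \<in> rational_closure"
proof -
  have "- x = nc_scale (- 1) x"
    by transfer auto
  then show "x \<in> rational_closure \<Longrightarrow> - x \<in> rational_closure"
    using rational_closure_scale by metis
qed

lemma rational_closure_diff:
  "x \<in> rational_closure \<Longrightarrow> y \<in> rational_closure \<Longrightarrow> x - y \<in> rational_closure"
  using rational_closure_add[of x "- y"] rational_closure_uminus[of y] by simp

lemma rational_closure_var: "(nc_var i :: ('k::comm_ring_1, 'n) ncfps) \<in> rational_closure"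
proof -
  have "nc_var i = (fa_to_nc (fa_var i) :: ('k, 'n) ncfps)"
    by (rule ncfps_eqI)
       (auto simp: nc_var.rep_eq fa_to_nc_def fa_var_def Abs_ncfps_inverse lookup_single when_def)
  then show ?thesis
    by (simp add: rational_closure_fa)
qed

lemma rational_closure_letter: "letter_to_nc x \<in> rational_closure"
  unfolding letter_to_nc_def
  by (auto intro!: rational_closure_add rational_closure_one rational_closure_var
      rational_closure_quasi_inverse rational_closure_uminus simp: nc_var.rep_eq uminus_ncfps.rep_eq)

lemma rational_closure_fg: "fg_to_nc g \<in> rational_closure"
proof -
  have "prod_list (map letter_to_nc w) \<in> rational_closure" for w :: "('n \<times> bool) list"
    by (induction w) (auto intro: rational_closure_one rational_closure_mult rational_closure_letter)
  then show ?thesis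
    by (simp add: fg_to_nc_def)
qed

lemma rational_closure_fga: "fga_to_nc p \<in> rational_closure"
proof -
  have "finite A \<Longrightarrow> (\<Sum>g\<in>A. nc_scale (Poly_Mapping.lookup p g) (fg_to_nc g)) \<in> rational_closure" for A
    by (induction A rule: finite_induct)
       (auto intro: rational_closure_zero rational_closure_add rational_closure_scale rational_closure_fg)
  then show ?thesis
    by (simp add: fga_to_nc_def)
qed

typedef (overloaded) ('k, 'n) ncrat = "rational_closure :: ('k::comm_ring_1, 'n) ncfps set"
  morphisms nc_of_rat Abs_ncrat
  using rational_closure_one by blast

setup_lifting type_definition_ncrat

instantiation ncrat :: (comm_ring_1, type) ring_1
begin

lift_definition zero_ncrat :: "('a, 'b) ncrat" is 0 by (rule rational_closure_zero)
lift_definition one_ncrat :: "('a, 'b) ncrat" is 1 by (rule rational_closure_one)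
lift_definition plus_ncrat :: "('a, 'b) ncrat \<Rightarrow> ('a, 'b) ncrat \<Rightarrow> ('a, 'b) ncrat"
  is "(+)" by (rule rational_closure_add)
lift_definition minus_ncrat :: "('a, 'b) ncrat \<Rightarrow> ('a, 'b) ncrat \<Rightarrow> ('a, 'b) ncrat"
  is "(-)" by (rule rational_closure_diff)
lift_definition uminus_ncrat :: "('a, 'b) ncrat \<Rightarrow> ('a, 'b) ncrat"
  is uminus by (rule rational_closure_uminus)
lift_definition times_ncrat :: "('a, 'b) ncrat \<Rightarrow> ('a, 'b) ncrat \<Rightarrow> ('a, 'b) ncrat"
  is "(*)" by (rule rational_closure_mult)

instance
  by standard (transfer; simp add: algebra_simps)+

end

lift_definition ncrat_scale :: "'k::comm_ring_1 \<Rightarrow> ('k, 'n) ncrat \<Rightarrow> ('k, 'n) ncrat"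
  is nc_scale by (rule rational_closure_scale)

lift_definition fa_to_ncrat :: "('k::comm_ring_1, 'n) free_algebra \<Rightarrow> ('k, 'n) ncrat"
  is fa_to_nc by (rule rational_closure_fa)

lift_definition fga_to_ncrat :: "('k::comm_ring_1, 'n) free_group_algebra \<Rightarrow> ('k, 'n) ncrat"
  is fga_to_nc by (rule rational_closure_fga)

end

theory Submission
  imports Defs "HOL-Computational_Algebra.Polynomial" "HOL-Library.Function_Algebras"
    "HOL-Library.Product_Plus" "HOL-Library.Sublist"
begin

text \<open>Let \<open>f\<close> be a homomorphism from the free algebra to \<open>S\<close> that inverts \<open>1 + M\<close>. In the product of
  the power series algebra and \<open>S\<close>, consider the components of solutions of finite linear systems
  \<open>y = v + \<Sum>\<^sub>i \<xi>\<^sub>i Q\<^sub>i y\<close> with \<open>v\<close> and \<open>Q\<^sub>i\<close> over \<open>'k\<close> and \<open>\<xi>\<^sub>i = (x\<^sub>i, f x\<^sub>i)\<close>, and their linear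
  combinations. They form a subalgebra whose projection to the power series contains the rational
  closure, and it is the graph of the required extension of \<open>f\<close> as soon as \<open>(0, t)\<close> in it forces
  \<open>t = 0\<close>. If \<open>\<Sum>\<^sub>a u\<^sub>a y\<^sub>a = 0\<close>, then the module spanned by the coefficient vectors of \<open>y\<close> is killed by
  \<open>u\<close>; by Hilbert's basis theorem it has a finite spanning set. The system lifts to the
  free module on this set, and there \<open>u\<close> becomes \<open>0\<close>, so \<open>t = 0\<close>.

  The group algebra follows from the free algebra by restricting homomorphisms to \<open>'k\<langle>x\<^sub>1, \<dots>, x\<^sub>n\<rangle>\<close>.
  It embeds into the power series by Magnus's theorem, proved with Fox derivatives.\<close>

section \<open>Algebras and homomorphisms\<close>

text \<open>The obstacle is that a system for \<open>0\<close> may have a nonzero solution vector,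
  and nothing makes it minimal. Over a field one could reduce it to a minimal one. Over
  \<open>'k\<close> the module spanned by the coefficient vectors need not be free, so a free module
  mapping onto it takes its place. Nor need that module be finitely generated, as \<open>'k\<close>
  may fail to be noetherian; but a system involves only finitely many elements of \<open>'k\<close>,
  and these lie in a noetherian subring. The system
  \<open>y = v + \<Sum>i. \<xi>\<^sub>i Q\<^sub>i y\<close> has the matrix
  \<open>1 - \<Sum>i. \<xi>\<^sub>i Q\<^sub>i\<close>, whose preimage over the free algebra lies in
  \<open>1 + M\<close>. Inverting it in \<open>S\<close> gives existence of solutions, which
  produces the second coordinates of quasi-inverses and of the lifted system, and uniqueness, which
  compares the lifted system with the given one. Being closed under linear combinations, the set is
  single-valued as soon as \<open>0\<close> has only the partner \<open>0\<close>.\<close>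

lemma algebra_homI:
  assumes "unital_algebra sR" "unital_algebra sS"
    and "\<And>x y. f (x + y) = f x + f y" "\<And>c x. f (sR c x) = sS c (f x)"
    and "\<And>x y. f (x * y) = f x * f y" "f 1 = 1"
  shows "algebra_hom sR sS f"
  using assms unfolding algebra_hom_def algebra_hom_axioms_def module_hom_iff unital_algebra_def by blast

lemma algebra_homD:
  assumes "algebra_hom sR sS f"
  shows "unital_algebra sR" "unital_algebra sS"
    and "f (x + y) = f x + f y" "f (sR c x) = sS c (f x)" "f (x * y) = f x * f y" "f 1 = 1"
    and "f 0 = 0" "f (- x) = - f x" "f (x - y) = f x - f y" "f (sum h A) = (\<Sum>a\<in>A. f (h a))"
proof -
  interpret algebra_hom sR sS f by fact
  show "unital_algebra sR" "unital_algebra sS" by unfold_locales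
  show "f (x + y) = f x + f y" "f (sR c x) = sS c (f x)" "f (x * y) = f x * f y" "f 1 = 1"
    "f 0 = 0" "f (- x) = - f x" "f (x - y) = f x - f y" "f (sum h A) = (\<Sum>a\<in>A. f (h a))"
    by (simp_all add: add scale mult one zero neg diff sum)
qed

lemma algebra_hom_comp:
  assumes "algebra_hom sR sS f" "algebra_hom sS sT g"
  shows "algebra_hom sR sT (g \<circ> f)"
  by (rule algebra_homI) (simp_all add: algebra_homD[OF assms(1)] algebra_homD[OF assms(2)])

lemma inverse_unique_monoid:
  fixes a b c :: "'a::monoid_mult"
  assumes "a * b = 1" "b * c = 1"
  shows "a = c"
  using assms by (metis mult.assoc mult_1_left mult_1_right)

lemma pm_scale_eq: "pm_scale c p = Poly_Mapping.single 0 c * p"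
  by (simp add: pm_scale_def mult_map_scale_conv_mult)

lemma pm_scale_single: "pm_scale c (Poly_Mapping.single g d) = Poly_Mapping.single g (c * d)"
  by (simp add: pm_scale_def map_single)

lemma poly_mapping_eq_sum_single: "p = (\<Sum>g\<in>Poly_Mapping.keys p. Poly_Mapping.single g (Poly_Mapping.lookup p g))"
proof (rule poly_mapping_eqI)
  fix k
  have "(\<Sum>g\<in>Poly_Mapping.keys p. Poly_Mapping.lookup p g when g = k) =
      (\<Sum>g\<in>Poly_Mapping.keys p. if g = k then Poly_Mapping.lookup p g else 0)"
    by (intro sum.cong) (auto simp: when_def)
  then show "Poly_Mapping.lookup p k =
      Poly_Mapping.lookup (\<Sum>g\<in>Poly_Mapping.keys p. Poly_Mapping.single g (Poly_Mapping.lookup p g)) k"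
    by (auto simp: lookup_sum lookup_single not_in_keys_iff_lookup_eq_zero)
qed

lemma unital_algebra_pm_scale: "unital_algebra (pm_scale :: 'k::comm_ring_1 \<Rightarrow> ('a::monoid_add \<Rightarrow>\<^sub>0 'k) \<Rightarrow> _)"
proof -
  \<comment> \<open>The monoid need not be commutative, but its neutral element commutes with
    everything, so scalars are central.\<close>
  have comm: "x * Poly_Mapping.single 0 c = Poly_Mapping.single 0 c * x" for c :: 'k and x :: "'a \<Rightarrow>\<^sub>0 'k"
    by (subst (1 2) poly_mapping_eq_sum_single[of x])
       (simp add: sum_distrib_left sum_distrib_right mult_single mult.commute)
  show ?thesis
  proof unfold_locales
    fix a b :: 'k and x y :: "'a \<Rightarrow>\<^sub>0 'k"
    show "pm_scale a (pm_scale b x) = pm_scale (a * b) x"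
      by (simp add: pm_scale_eq mult_single flip: mult.assoc)
    show "x * pm_scale a y = pm_scale a (x * y)"
      unfolding pm_scale_eq by (metis comm mult.assoc)
  qed (simp_all add: pm_scale_eq distrib_left distrib_right single_add mult.assoc)
qed

lemma unital_algebra_nc_scale: "unital_algebra nc_scale"
  by unfold_locales (transfer; simp add: algebra_simps sum_distrib_left)+

lemma unital_algebra_ncrat_scale: "unital_algebra ncrat_scale"
proof -
  interpret unital_algebra nc_scale by (rule unital_algebra_nc_scale)
  show ?thesis
    by unfold_locales
      (transfer; simp add: scale_right_distrib scale_left_distrib scale_mult_left scale_mult_right)+
qed

text \<open>The universal property of the monoid algebra, from which \<open>fa_to_nc\<close>,
  \<open>fga_to_nc\<close> and \<open>fa_to_fga\<close> get their multiplicativity. Since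
  \<open>keys\<close> is not additive, \<open>superset\<close> first moves all sums to a common
  finite index set.\<close>

lemma (in unital_algebra) algebra_hom_monoid_algebra:
  fixes \<phi> :: "'m::monoid_add \<Rightarrow> 'r"
  assumes "\<phi> 0 = 1" "\<And>g h. \<phi> (g + h) = \<phi> g * \<phi> h"
  shows "algebra_hom pm_scale scale
    (\<lambda>p. \<Sum>g\<in>Poly_Mapping.keys p. scale (Poly_Mapping.lookup p g) (\<phi> g))"
    (is "algebra_hom _ _ ?h")
proof -
  have superset: "?h p = (\<Sum>g\<in>A. scale (Poly_Mapping.lookup p g) (\<phi> g))"
    if "finite A" "Poly_Mapping.keys p \<subseteq> A" for p A
    using that by (intro sum.mono_neutral_left) (auto simp: in_keys_iff)
  have single: "?h (Poly_Mapping.single g c) = scale c (\<phi> g)" for g c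
    by (subst superset[of "{g}"]) (auto simp: lookup_single)
  have add: "?h (p + q) = ?h p + ?h q" for p q
  proof -
    let ?A = "Poly_Mapping.keys p \<union> Poly_Mapping.keys q"
    have "?h (p + q) = (\<Sum>g\<in>?A. scale (Poly_Mapping.lookup (p + q) g) (\<phi> g))"
      using keys_add[of p q] by (intro superset) auto
    also have "\<dots> = (\<Sum>g\<in>?A. scale (Poly_Mapping.lookup p g) (\<phi> g)) +
        (\<Sum>g\<in>?A. scale (Poly_Mapping.lookup q g) (\<phi> g))"
      by (simp only: lookup_add scale_left_distrib sum.distrib)
    also have "\<dots> = ?h p + ?h q"
      by (intro arg_cong2[of _ _ _ _ "(+)"] superset[symmetric]) auto
    finally show ?thesis .
  qed
  have zero: "?h 0 = 0" by simp
  have sum: "?h (sum F A) = (\<Sum>a\<in>A. ?h (F a))" for F and A :: "'x set"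
    by (induction A rule: infinite_finite_induct) (simp_all only: sum.insert sum.empty sum.infinite add zero not_False_eq_True)
  have mult: "?h (p * q) = ?h p * ?h q" for p q
  proof -
    have "p * q = (\<Sum>g\<in>Poly_Mapping.keys p. \<Sum>h\<in>Poly_Mapping.keys q.
        Poly_Mapping.single (g + h) (Poly_Mapping.lookup p g * Poly_Mapping.lookup q h))"
      by (subst (1) poly_mapping_eq_sum_single[of p], subst (1) poly_mapping_eq_sum_single[of q])
         (simp add: sum_distrib_left sum_distrib_right mult_single, rule sum.swap)
    then have "?h (p * q) = (\<Sum>g\<in>Poly_Mapping.keys p. \<Sum>h\<in>Poly_Mapping.keys q.
        scale (Poly_Mapping.lookup p g * Poly_Mapping.lookup q h) (\<phi> g * \<phi> h))"
      by (simp only: sum single assms(2))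
    also have "\<dots> = ?h p * ?h q"
      by (simp add: sum_product scale_mult_left scale_mult_right mult.commute)
    finally show ?thesis .
  qed
  have scale: "?h (pm_scale c p) = scale c (?h p)" for c p
    by (simp only: pm_scale_eq mult single assms(1) scale_mult_left) simp
  have one: "?h 1 = 1"
    using single[of 0 1] by (simp only: single_one) (simp add: assms(1))
  show ?thesis
    by (rule algebra_homI[OF unital_algebra_pm_scale unital_algebra_axioms add scale mult one])
qed

lemma algebra_hom_pm_eqI:
  assumes "algebra_hom pm_scale s f" "algebra_hom pm_scale s g"
    and "\<And>m. f (Poly_Mapping.single m 1) = g (Poly_Mapping.single m 1)"
  shows "f = g"
proof
  fix p
  have "f (Poly_Mapping.single m c) = g (Poly_Mapping.single m c)" for m c
    using assms(3)[of m] algebra_homD(4)[OF assms(1), of c "Poly_Mapping.single m 1"]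
      algebra_homD(4)[OF assms(2), of c "Poly_Mapping.single m 1"]
    by (simp add: pm_scale_single)
  then show "f p = g p"
    by (subst (1 2) poly_mapping_eq_sum_single[of p])
       (simp only: algebra_homD(10)[OF assms(1)] algebra_homD(10)[OF assms(2)])
qed

section \<open>The free algebra and the free group algebra\<close>

lemma single_Word_Cons: "Poly_Mapping.single (Word (i # w)) 1 = fa_var i * Poly_Mapping.single (Word w) 1"
  by (simp add: fa_var_def mult_single plus_free_monoid_def)

lemma fa_hom_eqI:
  assumes "algebra_hom pm_scale s f" "algebra_hom pm_scale s g"
    and "\<And>i. f (fa_var i) = g (fa_var i)"
  shows "f = g"
proof (rule algebra_hom_pm_eqI[OF assms(1,2)])
  fix m :: "'b free_monoid"
  obtain w where "m = Word w" by (cases m)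
  moreover have "f (Poly_Mapping.single (Word w) 1) = g (Poly_Mapping.single (Word w) 1)"
  proof (induction w)
    case Nil
    have "Poly_Mapping.single (Word []) 1 = (1 :: ('a, 'b) free_algebra)"
      by (simp flip: zero_free_monoid_def)
    then show ?case
      by (simp add: algebra_homD(6)[OF assms(1)] algebra_homD(6)[OF assms(2)])
  next
    case (Cons i w)
    then show ?case
      by (simp only: single_Word_Cons algebra_homD(5)[OF assms(1)] algebra_homD(5)[OF assms(2)] assms(3))
  qed
  ultimately show "f (Poly_Mapping.single m 1) = g (Poly_Mapping.single m 1)" by simp
qed

lemma Abs_free_group_Cons:
  assumes "reduced (x # w)"
  shows "Abs_free_group (x # w) = Abs_free_group [x] + Abs_free_group w"
proof -
  have "reduced w" by (rule reduced_ConsD[OF assms])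
  moreover have "reduced [x]" unfolding reduced_def by simp
  moreover have "reduced_append [x] w = x # w"
    using assms by (cases w) (auto simp: reduced_append_def reduced_def)
  ultimately have "reduced_word (Abs_free_group [x] + Abs_free_group w) = x # w"
    by (simp add: plus_free_group.rep_eq Abs_free_group_inverse)
  then show ?thesis by (metis reduced_word_inverse)
qed

lemma Abs_free_group_letter: "Abs_free_group [(i, b)] = (if b then fg_gen i else - fg_gen i)"
proof -
  have "reduced_word (- fg_gen i) = [(i, False)]" "reduced_word (fg_gen i) = [(i, True)]"
    by (simp_all add: uminus_free_group.rep_eq fg_gen.rep_eq inv_letter_def)
  then show ?thesis by (metis reduced_word_inverse)
qed

text \<open>Agreement on \<open>t\<^sub>i - 1\<close> gives agreement on \<open>t\<^sub>i\<close>
  and, inverses being unique, on the inverse of \<open>t\<^sub>i\<close>. A reduced word is the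
  product of its letters.\<close>

lemma fga_hom_eqI:
  assumes "algebra_hom pm_scale s f" "algebra_hom pm_scale s g"
    and "\<And>i. f (fga_var i) = g (fga_var i)"
  shows "f = g"
proof (rule algebra_hom_pm_eqI[OF assms(1,2)])
  note fD = algebra_homD[OF assms(1)] and gD = algebra_homD[OF assms(2)]
  have gen: "f (Poly_Mapping.single (fg_gen i) 1) = g (Poly_Mapping.single (fg_gen i) 1)" for i
    using assms(3)[of i] by (simp add: fga_var_def fD(6,9) gD(6,9))
  have inv: "f (Poly_Mapping.single (- fg_gen i) 1) = g (Poly_Mapping.single (- fg_gen i) 1)" for i
  proof (rule inverse_unique_monoid)
    show "f (Poly_Mapping.single (- fg_gen i) 1) * f (Poly_Mapping.single (fg_gen i) 1) = 1"
      by (simp add: fD(5,6) mult_single flip: fD(5))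
    show "f (Poly_Mapping.single (fg_gen i) 1) * g (Poly_Mapping.single (- fg_gen i) 1) = 1"
      unfolding gen by (simp add: gD(5,6) mult_single flip: gD(5))
  qed
  fix m :: "'b free_group"
  have "f (Poly_Mapping.single (Abs_free_group w) 1) = g (Poly_Mapping.single (Abs_free_group w) 1)"
    if "reduced w" for w
    using that
  proof (induction w)
    case Nil
    have "Poly_Mapping.single (Abs_free_group []) 1 = (1 :: ('a, 'b) free_group_algebra)"
      by (simp flip: zero_free_group_def)
    then show ?case by (simp add: fD gD)
  next
    case (Cons x w)
    have "Poly_Mapping.single (Abs_free_group (x # w)) 1 =
        (Poly_Mapping.single (Abs_free_group [x]) 1 * Poly_Mapping.single (Abs_free_group w) 1
          :: ('a, 'b) free_group_algebra)"
      by (simp add: mult_single Abs_free_group_Cons[OF Cons.prems])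
    moreover have "f (Poly_Mapping.single (Abs_free_group [x]) 1) = g (Poly_Mapping.single (Abs_free_group [x]) 1)"
      by (cases x) (auto simp: Abs_free_group_letter gen inv)
    ultimately show ?case
      using Cons by (auto simp: fD(5) gD(5) dest: reduced_ConsD)
  qed
  from this[of "reduced_word m"] show "f (Poly_Mapping.single m 1) = g (Poly_Mapping.single m 1)"
    using reduced_word[of m] by (simp add: reduced_word_inverse)
qed

section \<open>Power series\<close>

lemma nc_coeff_simps [simp]:
  "nc_coeff 0 w = 0" "nc_coeff 1 w = (if w = [] then 1 else 0)"
  "nc_coeff (f + g) w = nc_coeff f w + nc_coeff g w"
  "nc_coeff (f - g) w = nc_coeff f w - nc_coeff g w"
  "nc_coeff (- f) w = - nc_coeff f w"
  "nc_coeff (nc_scale c f) w = c * nc_coeff f w"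
  "nc_coeff (nc_var i) w = (if w = [i] then 1 else 0)"
  "nc_coeff (f * g) [] = nc_coeff f [] * nc_coeff g []"
  "nc_coeff (quasi_inverse f) [] = 0"
  by (simp_all add: zero_ncfps.rep_eq one_ncfps.rep_eq plus_ncfps.rep_eq minus_ncfps.rep_eq
      uminus_ncfps.rep_eq nc_scale.rep_eq nc_var.rep_eq times_ncfps.rep_eq nc_coeff_quasi_inverse)

lemma nc_coeff_sum [simp]: "nc_coeff (sum f A) w = (\<Sum>a\<in>A. nc_coeff (f a) w)"
  by (induction A rule: infinite_finite_induct) auto

lemma nc_coeff_var_times_Cons [simp]:
  "nc_coeff (nc_var i * f) (j # w) = (if i = j then nc_coeff f w else 0)"
proof -
  have "nc_coeff (nc_var i * f) (j # w) =
      (\<Sum>k\<le>Suc (length w). (if take k (j # w) = [i] then 1 else 0) * nc_coeff f (drop k (j # w)))"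
    by (simp add: times_ncfps.rep_eq)
  also have "\<dots> = (\<Sum>k\<le>Suc (length w). if k = 1 then (if i = j then nc_coeff f w else 0) else 0)"
  proof (rule sum.cong[OF refl])
    fix k assume "k \<in> {..Suc (length w)}"
    then show "(if take k (j # w) = [i] then 1 else 0) * nc_coeff f (drop k (j # w)) =
        (if k = 1 then (if i = j then nc_coeff f w else 0) else 0)"
      by (cases k) (auto split: if_splits)
  qed
  finally show ?thesis by (simp del: sum.atMost_Suc)
qed

lemma one_minus_times_quasi_inverse:
  fixes r :: "('k::comm_ring_1, 'n) ncfps"
  assumes "nc_coeff r [] = 0"
  shows "(1 - r) * (1 + quasi_inverse r) = 1" "(1 + quasi_inverse r) * (1 - r) = 1"
proof -
  have right: "(1 - r) * (1 + quasi_inverse r) = 1" if "nc_coeff r [] = 0" for r :: "('k, 'n) ncfps"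
    using quasi_inverse_unfold[OF that] by (simp add: algebra_simps)
  show "(1 - r) * (1 + quasi_inverse r) = 1" using right assms by simp
  \<comment> \<open>\<open>- quasi_inverse r\<close> has zero constant term as well, so
    \<open>1 + quasi_inverse r\<close> has a right inverse besides its left inverse
    \<open>1 - r\<close>, and the two agree.\<close>
  moreover have "(1 + quasi_inverse r) * (1 + quasi_inverse (- quasi_inverse r)) = 1"
    using right[of "- quasi_inverse r"] by simp
  ultimately show "(1 + quasi_inverse r) * (1 - r) = 1"
    using inverse_unique_monoid by metis
qed

lemma nc_coeff_prod_list_var:
  "nc_coeff (prod_list (map nc_var u)) w = (if w = u then 1 else (0 :: 'k::comm_ring_1))"
proof (induction u arbitrary: w)
  case (Cons i u)
  then show ?case by (cases w) auto
qed simp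

text \<open>Brings the coefficientwise definition into the shape of
  \<open>algebra_hom_monoid_algebra\<close>, which avoids computing with convolutions.\<close>

lemma fa_to_nc_eq:
  "fa_to_nc (p :: ('k::comm_ring_1, 'n) free_algebra) = (\<Sum>g\<in>Poly_Mapping.keys p.
     nc_scale (Poly_Mapping.lookup p g) (prod_list (map nc_var (letters g))))"
proof (rule ncfps_eqI)
  fix w :: "'n list"
  have "(\<Sum>g\<in>Poly_Mapping.keys p. Poly_Mapping.lookup p g * (if w = letters g then 1 else 0)) =
      (\<Sum>g\<in>Poly_Mapping.keys p. if g = Word w then Poly_Mapping.lookup p g else 0)"
    by (intro sum.cong) auto
  then show "nc_coeff (fa_to_nc p) w = nc_coeff (\<Sum>g\<in>Poly_Mapping.keys p.
      nc_scale (Poly_Mapping.lookup p g) (prod_list (map nc_var (letters g)))) w"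
    by (auto simp: fa_to_nc_def Abs_ncfps_inverse nc_coeff_prod_list_var not_in_keys_iff_lookup_eq_zero)
qed

lemma algebra_hom_fa_to_nc: "algebra_hom pm_scale nc_scale fa_to_nc"
  unfolding fa_to_nc_eq[abs_def]
  by (rule unital_algebra.algebra_hom_monoid_algebra[OF unital_algebra_nc_scale])
     (auto simp: zero_free_monoid_def plus_free_monoid_def)

lemma inj_fa_to_nc: "inj (fa_to_nc :: ('k::comm_ring_1, 'b) free_algebra \<Rightarrow> _)"
proof (rule injI, rule poly_mapping_eqI)
  fix p q :: "('k::comm_ring_1, 'b) free_algebra" and m assume "fa_to_nc p = fa_to_nc q"
  then have "nc_coeff (fa_to_nc p) (letters m) = nc_coeff (fa_to_nc q) (letters m)" by simp
  then show "Poly_Mapping.lookup p m = Poly_Mapping.lookup q m"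
    by (simp add: fa_to_nc_def Abs_ncfps_inverse)
qed

lemma fa_to_nc_var [simp]: "fa_to_nc (fa_var i) = nc_var i"
  by (rule ncfps_eqI) (auto simp: fa_to_nc_def fa_var_def Abs_ncfps_inverse lookup_single when_def)

lemma letter_to_nc_inv_letter:
  "letter_to_nc x * letter_to_nc (inv_letter x) = (1 :: ('k::comm_ring_1, 'n) ncfps)"
  using one_minus_times_quasi_inverse[of "- nc_var (fst x) :: ('k, 'n) ncfps"]
  by (simp add: letter_to_nc_def inv_letter_def)

lemma prod_list_reduced_Cons:
  "prod_list (map letter_to_nc (reduced_Cons x w)) = letter_to_nc x * prod_list (map letter_to_nc w)"
  by (cases w) (auto simp: letter_to_nc_inv_letter simp flip: mult.assoc)

lemma fg_to_nc_add: "fg_to_nc (g + h) = fg_to_nc g * fg_to_nc h"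
proof -
  have "prod_list (map letter_to_nc (reduced_append u v)) =
      prod_list (map letter_to_nc u) * prod_list (map letter_to_nc v)" for u v
    by (induction u) (simp_all add: reduced_append_def prod_list_reduced_Cons mult.assoc)
  then show ?thesis by (simp add: fg_to_nc_def plus_free_group.rep_eq)
qed

lemma fg_to_nc_zero: "fg_to_nc 0 = 1"
  by (simp add: fg_to_nc_def zero_free_group.rep_eq)

lemma algebra_hom_fga_to_nc: "algebra_hom pm_scale nc_scale fga_to_nc"
  unfolding fga_to_nc_def[abs_def]
  by (rule unital_algebra.algebra_hom_monoid_algebra[OF unital_algebra_nc_scale])
     (simp_all add: fg_to_nc_zero fg_to_nc_add)

lemma fga_to_nc_var [simp]: "fga_to_nc (fga_var i) = (nc_var i :: ('k::comm_ring_1, 'n) ncfps)"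
proof -
  have "fga_to_nc (Poly_Mapping.single (fg_gen i) 1) = 1 + (nc_var i :: ('k, 'n) ncfps)"
    by (auto simp: fga_to_nc_def fg_to_nc_def fg_gen.rep_eq letter_to_nc_def intro!: ncfps_eqI)
  then show ?thesis
    by (simp add: fga_var_def algebra_homD[OF algebra_hom_fga_to_nc])
qed

section \<open>The rational closure\<close>

lemma nc_of_rat_simps [simp]:
  "nc_of_rat 0 = 0" "nc_of_rat 1 = 1" "nc_of_rat (x + y) = nc_of_rat x + nc_of_rat y"
  "nc_of_rat (x - y) = nc_of_rat x - nc_of_rat y" "nc_of_rat (- x) = - nc_of_rat x"
  "nc_of_rat (x * y) = nc_of_rat x * nc_of_rat y" "nc_of_rat (ncrat_scale c x) = nc_scale c (nc_of_rat x)"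
  "nc_of_rat (fa_to_ncrat p) = fa_to_nc p" "nc_of_rat (fga_to_ncrat q) = fga_to_nc q"
  by (simp_all add: zero_ncrat.rep_eq one_ncrat.rep_eq plus_ncrat.rep_eq minus_ncrat.rep_eq
      uminus_ncrat.rep_eq times_ncrat.rep_eq ncrat_scale.rep_eq fa_to_ncrat.rep_eq fga_to_ncrat.rep_eq)

lemma nc_of_rat_sum [simp]: "nc_of_rat (sum f A) = (\<Sum>a\<in>A. nc_of_rat (f a))"
  by (induction A rule: infinite_finite_induct) auto

lemmas nc_of_rat_eqI = nc_of_rat_inject[THEN iffD1]

lemma algebra_hom_fa_to_ncrat: "algebra_hom pm_scale ncrat_scale fa_to_ncrat"
  by (rule algebra_homI[OF unital_algebra_pm_scale unital_algebra_ncrat_scale]; rule nc_of_rat_eqI)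
     (simp_all add: algebra_homD[OF algebra_hom_fa_to_nc])

lemma algebra_hom_fga_to_ncrat: "algebra_hom pm_scale ncrat_scale fga_to_ncrat"
  by (rule algebra_homI[OF unital_algebra_pm_scale unital_algebra_ncrat_scale]; rule nc_of_rat_eqI)
     (simp_all add: algebra_homD[OF algebra_hom_fga_to_nc])

lemma rational_closure_subset:
  assumes "unital_subalgebra nc_scale B" "range fa_to_nc \<subseteq> B"
    and "\<And>r. r \<in> B \<Longrightarrow> nc_coeff r [] = 0 \<Longrightarrow> quasi_inverse r \<in> B"
  shows "rational_closure \<subseteq> B"
  unfolding rational_closure_def using assms by (intro Inter_lower) auto

lemma ncrat_one_minus_invertible:
  assumes "nc_coeff (nc_of_rat r) [] = 0"
  obtains q where "nc_of_rat q = quasi_inverse (nc_of_rat r)" "(1 - r) * (1 + q) = 1" "(1 + q) * (1 - r) = 1"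
proof -
  have "quasi_inverse (nc_of_rat r) \<in> rational_closure"
    using assms nc_of_rat by (intro rational_closure_quasi_inverse) auto
  then obtain q where q: "nc_of_rat q = quasi_inverse (nc_of_rat r)"
    by (metis Abs_ncrat_inverse)
  with one_minus_times_quasi_inverse[OF assms] show ?thesis
    by (intro that[of q]; (intro nc_of_rat_eqI)?) simp_all
qed

text \<open>The elements on which both maps agree are closed under quasi-inverses, because a
  homomorphism sends the inverse of \<open>1 - r\<close> to the inverse of the image. By minimality
  they exhaust the rational closure.\<close>

lemma ncrat_hom_eqI:
  assumes g1: "algebra_hom ncrat_scale s g1" and g2: "algebra_hom ncrat_scale s g2"
    and eq: "\<And>p. g1 (fa_to_ncrat p) = g2 (fa_to_ncrat p)"
  shows "g1 = g2"
proof
  fix r :: "('a, 'b) ncrat"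
  let ?B = "nc_of_rat ` {r. g1 r = g2 r}"
  note D1 = algebra_homD[OF g1] and D2 = algebra_homD[OF g2]
  have "unital_subalgebra nc_scale ?B"
    unfolding unital_subalgebra_def
    by (auto simp: image_iff D1 D2 simp flip: nc_of_rat_simps)
       (metis D1(3,4,5,6) D2(3,4,5,6))+
  moreover have "range fa_to_nc \<subseteq> ?B"
    using eq by (auto simp: image_iff) (metis nc_of_rat_simps(8))
  moreover have "quasi_inverse x \<in> ?B" if "x \<in> ?B" "nc_coeff x [] = 0" for x
  proof -
    from that obtain r where r: "x = nc_of_rat r" "g1 r = g2 r" by auto
    with that obtain q where q: "nc_of_rat q = quasi_inverse x" "(1 - r) * (1 + q) = 1" "(1 + q) * (1 - r) = 1"
      using ncrat_one_minus_invertible by metis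
    have "g1 (1 + q) * g1 (1 - r) = 1" "g2 (1 - r) * g2 (1 + q) = 1"
      using q D1(5,6) D2(5,6) by metis+
    moreover have "g1 (1 - r) = g2 (1 - r)" using r by (simp add: D1 D2)
    ultimately have "g1 (1 + q) = g2 (1 + q)" using inverse_unique_monoid by metis
    then have "g1 q = g2 q" by (simp add: D1 D2)
    then show ?thesis by (simp flip: q(1))
  qed
  ultimately have "rational_closure \<subseteq> ?B" by (rule rational_closure_subset)
  then have "nc_of_rat r \<in> ?B" using nc_of_rat by auto
  then show "g1 r = g2 r" by (auto simp: nc_of_rat_inject)
qed

section \<open>Noetherian subrings\<close>

definition is_subring :: "'k::comm_ring_1 set \<Rightarrow> bool" where
  "is_subring B \<longleftrightarrow> 1 \<in> B \<and> (\<forall>a\<in>B. \<forall>b\<in>B. a - b \<in> B \<and> a * b \<in> B)"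

text \<open>A module over \<open>'k\<close> is regarded here as a module over a subring
  \<open>B\<close>. The subring is a set, since it will depend on the coefficients of a given
  system.\<close>

definition submodule_over :: "('k \<Rightarrow> 'm::ab_group_add \<Rightarrow> 'm) \<Rightarrow> 'k set \<Rightarrow> 'm set \<Rightarrow> bool" where
  "submodule_over s B N \<longleftrightarrow> 0 \<in> N \<and> (\<forall>x\<in>N. \<forall>y\<in>N. x + y \<in> N) \<and> (\<forall>b\<in>B. \<forall>x\<in>N. s b x \<in> N)"

inductive_set lincomb :: "('k \<Rightarrow> 'm::ab_group_add \<Rightarrow> 'm) \<Rightarrow> 'k set \<Rightarrow> 'm set \<Rightarrow> 'm set"
  for s B X where
  zero: "0 \<in> lincomb s B X"
| step: "b \<in> B \<Longrightarrow> x \<in> X \<Longrightarrow> y \<in> lincomb s B X \<Longrightarrow> s b x + y \<in> lincomb s B X"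

definition noetherian :: "'k::comm_ring_1 set \<Rightarrow> bool" where
  "noetherian B \<longleftrightarrow> is_subring B \<and>
     (\<forall>N\<subseteq>B. submodule_over (*) B N \<longrightarrow> (\<exists>Y\<subseteq>N. finite Y \<and> N \<subseteq> lincomb (*) B Y))"

lemma is_subring_closed:
  assumes "is_subring B"
  shows "0 \<in> B" "1 \<in> B" "a \<in> B \<Longrightarrow> - a \<in> B" "a \<in> B \<Longrightarrow> b \<in> B \<Longrightarrow> a + b \<in> B"
    "a \<in> B \<Longrightarrow> b \<in> B \<Longrightarrow> a - b \<in> B" "a \<in> B \<Longrightarrow> b \<in> B \<Longrightarrow> a * b \<in> B"
proof -
  show 0: "0 \<in> B" "1 \<in> B" "a \<in> B \<Longrightarrow> b \<in> B \<Longrightarrow> a - b \<in> B" "a \<in> B \<Longrightarrow> b \<in> B \<Longrightarrow> a * b \<in> B" for a b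
    using assms unfolding is_subring_def by (metis diff_self)+
  show neg: "a \<in> B \<Longrightarrow> - a \<in> B" for a
    using 0(3)[of 0 a] 0(1) by simp
  show "a \<in> B \<Longrightarrow> b \<in> B \<Longrightarrow> a + b \<in> B"
    using 0(3)[of a "- b"] neg by simp
qed

lemma is_subring_sum:
  assumes "is_subring B" "\<And>i. i \<in> I \<Longrightarrow> f i \<in> B"
  shows "sum f I \<in> B"
  using assms(2) by (induction I rule: infinite_finite_induct) (auto intro: is_subring_closed[OF assms(1)])

lemma lincomb_mono: "X \<subseteq> Y \<Longrightarrow> lincomb s B X \<subseteq> lincomb s B Y"
proof
  fix z assume "X \<subseteq> Y" "z \<in> lincomb s B X"
  then show "z \<in> lincomb s B Y"
    by (induction rule: lincomb.induct[OF \<open>z \<in> lincomb s B X\<close>]) (auto intro: lincomb.intros)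
qed

lemma lincomb_add: "x \<in> lincomb s B X \<Longrightarrow> y \<in> lincomb s B X \<Longrightarrow> x + y \<in> lincomb s B X"
  by (induction rule: lincomb.induct) (auto simp: add.assoc intro: lincomb.intros)

lemma lincomb_subset: "submodule_over s B N \<Longrightarrow> X \<subseteq> N \<Longrightarrow> lincomb s B X \<subseteq> N"
proof
  fix z assume "z \<in> lincomb s B X" "submodule_over s B N" "X \<subseteq> N"
  then show "z \<in> N"
    by (induction rule: lincomb.induct) (auto simp: submodule_over_def subset_iff)
qed

lemma (in Modules.module) submodule_over_lincomb:
  assumes "is_subring B"
  shows "submodule_over scale B (lincomb scale B X)"
proof -
  have "scale b x \<in> lincomb scale B X" if "x \<in> lincomb scale B X" "b \<in> B" for b x
    using that
    by (induction rule: lincomb.induct)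
       (auto simp: scale_right_distrib intro: lincomb.intros is_subring_closed[OF assms])
  then show ?thesis
    by (auto simp: submodule_over_def intro: lincomb.intros lincomb_add)
qed

lemma (in Modules.module) lincomb_base: "is_subring B \<Longrightarrow> x \<in> X \<Longrightarrow> x \<in> lincomb scale B X"
  using lincomb.step[of 1 B x X 0 scale] by (auto simp: is_subring_closed intro: lincomb.zero)

lemma lincomb_finite_subset:
  "x \<in> lincomb s B X \<Longrightarrow> \<exists>Y\<subseteq>X. finite Y \<and> x \<in> lincomb s B Y"
proof (induction rule: lincomb.induct)
  case zero
  show ?case by (rule exI[of _ "{}"]) (auto intro: lincomb.zero)
next
  case (step b x y)
  then obtain Y where "Y \<subseteq> X" "finite Y" "y \<in> lincomb s B Y"
    by blast
  with step lincomb_mono[of Y "insert x Y" s B] show ?case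
    by (intro exI[of _ "insert x Y"]) (auto intro: lincomb.step)
qed

text \<open>The map \<open>k\<close> on scalars allows semilinear \<open>h\<close>, such as a ring
  homomorphism with \<open>k = h\<close>.\<close>

lemma lincomb_image:
  assumes "\<And>x y. h (x + y) = h x + h y" "h 0 = 0" "\<And>b x. b \<in> B \<Longrightarrow> h (s b x) = t (k b) (h x)"
    "z \<in> lincomb s B X"
  shows "h z \<in> lincomb t (k ` B) (h ` X)"
  using assms(4) by (induction rule: lincomb.induct) (auto simp: assms(1-3) intro: lincomb.intros)

lemma lincomb_explicit:
  fixes s :: "'k::comm_ring_1 \<Rightarrow> 'm::ab_group_add \<Rightarrow> 'm"
  assumes "Modules.module s" "finite Y" "z \<in> lincomb s B Y"
  shows "\<exists>c. z = (\<Sum>y\<in>Y. s (c y) y)"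
  using assms(3)
proof (induction rule: lincomb.induct)
  interpret Modules.module s by fact
  {
    case zero
    then show ?case by (intro exI[of _ "\<lambda>_. 0"]) simp
  next
    case (step b x y)
    then obtain c where c: "y = (\<Sum>y\<in>Y. s (c y) y)" by blast
    have "s b x = (\<Sum>y\<in>Y. s (if y = x then b else 0) y)"
      using step assms(2) by (subst sum.mono_neutral_cong_right[of Y "{x}" _ "\<lambda>y. s b y"]) auto
    with c have "s b x + y = (\<Sum>y\<in>Y. s ((if y = x then b else 0) + c y) y)"
      by (simp add: scale_left_distrib sum.distrib)
    then show ?case by (intro exI[of _ "\<lambda>z. (if z = x then b else 0) + c z"])
  }
qed

lemma module_mult: "Modules.module ((*) :: 'k::comm_ring_1 \<Rightarrow> 'k \<Rightarrow> 'k)"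
  by unfold_locales (auto simp: algebra_simps)

text \<open>An ideal of the image pulls back to an ideal of \<open>B\<close>, and generators found
  there map to generators.\<close>

lemma noetherian_image:
  fixes h :: "'a::comm_ring_1 \<Rightarrow> 'b::comm_ring_1"
  assumes B: "noetherian B"
    and h: "\<And>x y. h (x + y) = h x + h y" "\<And>x y. h (x * y) = h x * h y" "h 1 = 1"
  shows "noetherian (h ` B)"
proof -
  interpret additive h by unfold_locales (rule h)
  have sub: "is_subring B" using B by (simp add: noetherian_def)
  have sub': "is_subring (h ` B)"
    unfolding is_subring_def
    by (auto simp: diff[symmetric] h(2)[symmetric] intro!: imageI is_subring_closed[OF sub])
       (metis h(3) image_eqI is_subring_closed(2)[OF sub])
  moreover have "\<exists>Y\<subseteq>N. finite Y \<and> N \<subseteq> lincomb (*) (h ` B) Y"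
    if N: "N \<subseteq> h ` B" "submodule_over (*) (h ` B) N" for N
  proof -
    let ?M = "B \<inter> h -` N"
    have "submodule_over (*) B ?M"
      using N(2) by (auto simp: submodule_over_def h zero intro: is_subring_closed[OF sub])
    then obtain Y where Y: "Y \<subseteq> ?M" "finite Y" "?M \<subseteq> lincomb (*) B Y"
      using B unfolding noetherian_def by (metis Int_lower1)
    have "N \<subseteq> lincomb (*) (h ` B) (h ` Y)"
    proof
      fix z assume "z \<in> N"
      then obtain x where x: "z = h x" "x \<in> ?M" using N(1) by auto
      then show "z \<in> lincomb (*) (h ` B) (h ` Y)"
        using Y(3) by (auto intro!: lincomb_image[where s = "(*)" and k = h] simp: h zero)
    qed
    with Y show ?thesis by (intro exI[of _ "h ` Y"]) auto
  qed
  ultimately show ?thesis by (simp add: noetherian_def)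
qed

text \<open>The start of the tower of rings: the integers, before any element is adjoined. Division
  by the least positive element \<open>d\<close> of a nonzero ideal leaves a smaller remainder in
  the ideal, which must be zero.\<close>

lemma noetherian_int: "noetherian (UNIV :: int set)"
proof -
  have "\<exists>Y\<subseteq>N. finite Y \<and> N \<subseteq> lincomb (*) UNIV Y" if N: "submodule_over (*) UNIV N" for N :: "int set"
  proof (cases "\<exists>x\<in>N. x \<noteq> 0")
    case False
    then show ?thesis by (intro exI[of _ "{}"]) (auto intro: lincomb.zero)
  next
    case True
    have mult: "a * x \<in> N" if "x \<in> N" for a x
      using N that by (simp add: submodule_over_def)
    have pos: "\<exists>x\<in>N. x > 0"
    proof -
      from True obtain x where "x \<in> N" "x \<noteq> 0" by blast
      then show ?thesis
        using mult[of x "-1"] by (cases "x > 0") (auto intro: bexI[of _ "- x"])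
    qed
    define d where "d = (LEAST n. n > 0 \<and> int n \<in> N)"
    have "\<exists>n. n > 0 \<and> int n \<in> N"
      using pos by (metis pos_int_cases)
    then have d: "d > 0" "int d \<in> N"
      unfolding d_def by (metis (mono_tags, lifting) LeastI)+
    have "x \<in> lincomb (*) UNIV {int d}" if "x \<in> N" for x
    proof -
      have "x mod int d = x + (- (x div int d)) * int d"
        using minus_div_mult_eq_mod[of x "int d"] by simp
      then have "x mod int d \<in> N"
        using N that mult[OF d(2)] unfolding submodule_over_def by metis
      moreover have "x mod int d = int (nat (x mod int d))" "nat (x mod int d) < d"
        using d(1) by (auto simp: nat_less_iff)
      ultimately have "\<not> nat (x mod int d) > 0"
        using not_less_Least[of "nat (x mod int d)" "\<lambda>n. n > 0 \<and> int n \<in> N"] by (auto simp: d_def)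
      then have "x = (x div int d) * int d"
        using d(1) by (metis add.right_neutral div_mult_mod_eq gr0I int_nat_eq nat_less_iff
            \<open>x mod int d = int (nat (x mod int d))\<close> of_nat_0)
      then show ?thesis
        using lincomb.step[of "x div int d" UNIV "int d" "{int d}" 0 "(*)"] lincomb.zero by auto
    qed
    with d show ?thesis by (intro exI[of _ "{int d}"]) auto
  qed
  then show ?thesis by (simp add: noetherian_def is_subring_def)
qed

definition polys_over :: "'k::comm_ring_1 set \<Rightarrow> 'k poly set" where
  "polys_over B = {p. \<forall>i. coeff p i \<in> B}"

lemma is_subring_polys_over:
  assumes "is_subring B"
  shows "is_subring (polys_over B)"
  unfolding is_subring_def polys_over_def
  by (auto simp: coeff_mult intro!: is_subring_closed[OF assms] is_subring_sum[OF assms])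

text \<open>Hilbert's basis theorem: the degree-\<open>d\<close> coefficients of the elements of degree at most \<open>d\<close> of an
  ideal form an ideal \<open>L d\<close> of \<open>B\<close>, and the chain of these becomes constant.\<close>

lemma noetherian_polys_over:
  assumes "noetherian B"
  shows "noetherian (polys_over B)"
proof -
  let ?P = "polys_over B"
  have sub: "is_subring B"
    and fg: "\<And>N. N \<subseteq> B \<Longrightarrow> submodule_over (*) B N \<Longrightarrow> \<exists>Y\<subseteq>N. finite Y \<and> N \<subseteq> lincomb (*) B Y"
    using assms by (auto simp: noetherian_def)
  note subP = is_subring_polys_over[OF sub]
  have "\<exists>Y\<subseteq>N. finite Y \<and> N \<subseteq> lincomb (*) ?P Y" if N: "N \<subseteq> ?P" "submodule_over (*) ?P N" for N
  proof -
    have N0: "0 \<in> N" and Nadd: "\<And>x y. x \<in> N \<Longrightarrow> y \<in> N \<Longrightarrow> x + y \<in> N"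
      and Nmult: "\<And>p x. p \<in> ?P \<Longrightarrow> x \<in> N \<Longrightarrow> p * x \<in> N"
      using N(2) by (auto simp: submodule_over_def)
    have const: "[:b:] \<in> ?P" if "b \<in> B" for b
      using that is_subring_closed(1)[OF sub] by (auto simp: polys_over_def coeff_pCons split: nat.split)
    have Nsmult: "smult b x \<in> N" if "b \<in> B" "x \<in> N" for b x
      using Nmult[OF const that(2)] that by simp
    have monP: "monom 1 d \<in> ?P" for d
      using is_subring_closed(1,2)[OF sub] by (auto simp: polys_over_def)
    have Nshift: "monom 1 d * x \<in> N" if "x \<in> N" for d x
      using Nmult[OF monP that] .
    have coeff_shift: "coeff (monom 1 d * x) i = (if i < d then 0 else coeff x (i - d))" for d i and x :: "'a poly"
      by (simp add: coeff_monom_mult)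
    define M where "M d = {p \<in> N. \<forall>i>d. coeff p i = 0}" for d
    define L where "L d = (\<lambda>p. coeff p d) ` M d" for d
    have LI: "coeff p d \<in> L d" if "p \<in> M d" for p d
      using that by (auto simp: L_def)
    have M0: "0 \<in> M d" and Madd: "x \<in> M d \<Longrightarrow> y \<in> M d \<Longrightarrow> x + y \<in> M d"
      and Msmult: "b \<in> B \<Longrightarrow> x \<in> M d \<Longrightarrow> smult b x \<in> M d" for d b x y
      by (auto simp: M_def N0 Nadd Nsmult)
    have LB: "L d \<subseteq> B" for d
      using N(1) by (auto simp: L_def M_def polys_over_def)
    have Lsub: "submodule_over (*) B (L d)" for d
      unfolding submodule_over_def
    proof (intro conjI ballI)
      show "0 \<in> L d" using LI[OF M0] by simp
    next
      fix x y assume "x \<in> L d" "y \<in> L d"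
      then obtain p q where "p \<in> M d" "q \<in> M d" "x = coeff p d" "y = coeff q d"
        by (auto simp: L_def)
      then show "x + y \<in> L d" using LI[OF Madd[of p d q]] by simp
    next
      fix b x assume "b \<in> B" "x \<in> L d"
      then obtain p where "p \<in> M d" "x = coeff p d"
        by (auto simp: L_def)
      then show "b * x \<in> L d" using LI[OF Msmult[of b p d]] \<open>b \<in> B\<close> by simp
    qed
    have Lmono: "L d \<subseteq> L e" if "d \<le> e" for d e
    proof
      fix b assume "b \<in> L d"
      then obtain p where p: "p \<in> M d" "b = coeff p d" by (auto simp: L_def)
      then have "monom 1 (e - d) * p \<in> M e"
        using that by (auto simp: M_def coeff_shift Nshift)
      from LI[OF this] show "b \<in> L e"
        using that p by (simp add: coeff_shift split: if_splits)
    qed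
    have "submodule_over (*) B (\<Union>d. L d)"
    proof -
      have "x + y \<in> (\<Union>d. L d)" if "x \<in> L d" "y \<in> L e" for x y d e
      proof -
        have "x \<in> L (max d e)" "y \<in> L (max d e)"
          using that Lmono[of d "max d e"] Lmono[of e "max d e"] by auto
        then show ?thesis using Lsub[of "max d e"] by (auto simp: submodule_over_def)
      qed
      then show ?thesis
        using Lsub by (fastforce simp: submodule_over_def)
    qed
    then obtain Z where Z: "Z \<subseteq> (\<Union>d. L d)" "finite Z" "(\<Union>d. L d) \<subseteq> lincomb (*) B Z"
      using fg[of "\<Union>d. L d"] LB by blast
    \<comment> \<open>Stabilization of the chain: the union of all \<open>L d\<close> has finitely
      many generators, and \<open>D\<close> is a degree by which all of them have appeared.\<close>
    obtain D where D: "Z \<subseteq> L D"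
    proof -
      have "\<forall>z\<in>Z. \<exists>d. z \<in> L d" using Z(1) by blast
      then obtain dd where dd: "\<forall>z\<in>Z. z \<in> L (dd z)" by metis
      have "z \<in> L (Max (insert 0 (dd ` Z)))" if "z \<in> Z" for z
        using Lmono[of "dd z" "Max (insert 0 (dd ` Z))"] Z(2) dd that by auto
      then show ?thesis using that by blast
    qed
    have LD: "L d \<subseteq> L D" for d
      using Z(3) lincomb_subset[OF Lsub D] by blast
    have "\<exists>Y. Y \<subseteq> M d \<and> finite Y \<and> L d \<subseteq> lincomb (*) B ((\<lambda>p. coeff p d) ` Y)" for d
    proof -
      obtain Y where Y: "Y \<subseteq> L d" "finite Y" "L d \<subseteq> lincomb (*) B Y"
        using fg[OF LB Lsub] by blast
      from Y(1,2) obtain Y' where "Y' \<subseteq> M d" "finite Y'" "Y = (\<lambda>p. coeff p d) ` Y'"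
        unfolding L_def using finite_subset_image by metis
      with Y show ?thesis by blast
    qed
    then obtain Y where Y: "\<And>d. Y d \<subseteq> M d" "\<And>d. finite (Y d)"
        "\<And>d. L d \<subseteq> lincomb (*) B ((\<lambda>p. coeff p d) ` Y d)"
      by metis
    let ?Y = "\<Union>d\<le>D. Y d"
    have YN: "?Y \<subseteq> N" using Y(1) by (auto simp: M_def)
    note subY = module.submodule_over_lincomb[OF module_mult subP, of ?Y]
    \<comment> \<open>Every possible leading coefficient in degree \<open>e\<close> is attained by
      an element of the span that has degree at most \<open>e\<close>, so subtracting it creates no
      higher terms.\<close>
    have lift: "\<exists>q\<in>M e. coeff q e = b \<and> q \<in> lincomb (*) ?P ?Y"
      if "b \<in> lincomb (*) B ((\<lambda>p. coeff p e) ` Y e)" "e \<le> D" for b e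
      using that(1)
    proof (induction rule: lincomb.induct)
      case zero
      show ?case using M0 by (auto intro!: bexI[of _ 0] lincomb.zero)
    next
      case (step b x y)
      then obtain p q where p: "p \<in> Y e" "x = coeff p e"
        and q: "q \<in> M e" "coeff q e = y" "q \<in> lincomb (*) ?P ?Y" by blast
      have "smult b p + q \<in> M e"
        using p q Y(1) step by (intro Madd Msmult) auto
      moreover have "[:b:] * p + q \<in> lincomb (*) ?P ?Y"
        using p q step that by (intro lincomb.step const) auto
      ultimately show ?case using p q by (intro bexI[of _ "smult b p + q"]) auto
    qed
    \<comment> \<open>Induction on a strict bound \<open>m\<close> for the degree, which covers the
      zero polynomial by \<open>m = 0\<close>.\<close>
    have "p \<in> lincomb (*) ?P ?Y" if "p \<in> N" "\<forall>i\<ge>m. coeff p i = 0" for p m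
      using that
    proof (induction m arbitrary: p)
      case 0
      then have "p = 0" by (simp add: poly_eq_iff)
      then show ?case by (simp add: lincomb.zero)
    next
      case (Suc m)
      \<comment> \<open>Beyond \<open>D\<close> no new leading coefficients occur, so one takes an
        element of degree at most \<open>D\<close> and raises it by \<open>monom 1 (m - e)\<close>
        to cancel the top term of \<open>p\<close>.\<close>
      define e where "e = min m D"
      have "coeff p m \<in> L m"
        using Suc.prems by (intro LI) (auto simp: M_def)
      then have "coeff p m \<in> L e"
        using LD by (auto simp: e_def min_def)
      then obtain q where q: "q \<in> M e" "coeff q e = coeff p m" "q \<in> lincomb (*) ?P ?Y"
        using lift[of "coeff p m" e] Y(3)[of e] by (auto simp: e_def)
      let ?q = "monom 1 (m - e) * q"
      have qin: "?q \<in> lincomb (*) ?P ?Y"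
        using subY q(3) monP by (auto simp: submodule_over_def)
      have "p + [:-1:] * ?q \<in> N"
        using q(1) Suc.prems const is_subring_closed(2,3)[OF sub] 
        by (intro Nadd Nmult monP) (auto simp: M_def)
      moreover have "\<forall>i\<ge>m. coeff (p + [:-1:] * ?q) i = 0"
      proof (intro allI impI)
        fix i assume "i \<ge> m"
        then consider "i = m" | "i \<ge> Suc m" by linarith
        then show "coeff (p + [:-1:] * ?q) i = 0"
        proof cases
          case 1
          then show ?thesis using q(2) by (simp add: coeff_shift e_def)
        next
          case 2
          then have "coeff q (i - (m - e)) = 0"
            using q(1) by (auto simp: M_def e_def)
          then show ?thesis using Suc.prems 2 by (simp add: coeff_shift)
        qed
      qed
      ultimately have "p + [:-1:] * ?q \<in> lincomb (*) ?P ?Y"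
        by (rule Suc.IH)
      from lincomb_add[OF this qin] show ?case by simp
    qed
    then have "N \<subseteq> lincomb (*) ?P ?Y"
      by (metis coeff_eq_0 less_eq_Suc_le subsetI)
    with YN Y(2) show ?thesis by (intro exI[of _ ?Y]) auto
  qed
  with subP show ?thesis by (simp add: noetherian_def)
qed

text \<open>\<open>C\<close> is \<open>B[a]\<close>, the image of the polynomial ring over
  \<open>B\<close> under evaluation at \<open>a\<close>.\<close>

lemma noetherian_adjoin:
  assumes "noetherian B"
  shows "\<exists>C. noetherian C \<and> insert a B \<subseteq> C"
proof (intro exI conjI)
  let ?h = "\<lambda>p. poly p a"
  show "noetherian (?h ` polys_over B)"
    by (intro noetherian_image noetherian_polys_over assms) auto
  have sub: "is_subring B" using assms by (simp add: noetherian_def)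
  have "[:b:] \<in> polys_over B" if "b \<in> B" for b
    using that is_subring_closed(1)[OF sub] by (auto simp: polys_over_def coeff_pCons split: nat.split)
  moreover have "[:0, 1:] \<in> polys_over B"
    using is_subring_closed(1,2)[OF sub] by (auto simp: polys_over_def coeff_pCons split: nat.split)
  ultimately show "insert a B \<subseteq> ?h ` polys_over B"
    by (force simp: image_iff intro: bexI[of _ "[:0, 1:]"] bexI[of _ "[:b:]" for b])
qed

lemma finite_subset_noetherian:
  assumes "finite E"
  shows "\<exists>B. noetherian B \<and> (E :: 'k::comm_ring_1 set) \<subseteq> B"
  using assms
proof induction
  case empty
  have "noetherian (range (of_int :: int \<Rightarrow> 'k))"
    by (rule noetherian_image[OF noetherian_int]) auto
  then show ?case by blast
next
  case (insert a E)
  then show ?case using noetherian_adjoin[of _ a] by (metis insert_mono order_trans)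
qed

section \<open>Submodules of finite free modules over a noetherian subring\<close>

definition fun_scale :: "'k::comm_ring_1 \<Rightarrow> ('a \<Rightarrow> 'k) \<Rightarrow> 'a \<Rightarrow> 'k" where
  "fun_scale c f = (\<lambda>a. c * f a)"

lemma fun_scale_apply: "fun_scale c f a = c * f a"
  by (simp add: fun_scale_def)

lemma module_fun_scale: "Modules.module (fun_scale :: 'k::comm_ring_1 \<Rightarrow> ('a \<Rightarrow> 'k) \<Rightarrow> 'a \<Rightarrow> 'k)"
  unfolding Modules.module_def
  by (intro conjI allI ext)
     (simp_all only: fun_scale_apply plus_fun_apply distrib_left distrib_right mult.assoc mult_1_left)

text \<open>Induction on \<open>I\<close>: evaluation at a new point \<open>a\<close> maps
  \<open>N\<close> onto an ideal of \<open>B\<close>, and the kernel is covered by the induction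
  hypothesis. Elements of the free module on \<open>I\<close> are functions on the whole type, hence
  the comparison on \<open>I\<close> only.\<close>

lemma noetherian_functions:
  fixes B :: "'k::comm_ring_1 set" and N :: "('a \<Rightarrow> 'k) set"
  assumes "noetherian B" "finite I" "submodule_over fun_scale B N" "\<And>f a. f \<in> N \<Longrightarrow> a \<in> I \<Longrightarrow> f a \<in> B"
  shows "\<exists>Y\<subseteq>N. finite Y \<and> (\<forall>f\<in>N. \<exists>g\<in>lincomb fun_scale B Y. \<forall>a\<in>I. f a = g a)"
  using assms(2-4)
proof (induction I arbitrary: N)
  case empty
  then show ?case by (intro exI[of _ "{}"]) (auto intro: lincomb.zero)
next
  case (insert a I)
  have sub: "is_subring B" using assms(1) by (simp add: noetherian_def)
  have N: "0 \<in> N" "\<And>x y. x \<in> N \<Longrightarrow> y \<in> N \<Longrightarrow> x + y \<in> N" "\<And>b x. b \<in> B \<Longrightarrow> x \<in> N \<Longrightarrow> fun_scale b x \<in> N"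
    using insert.prems(1) unfolding submodule_over_def by blast+
  let ?ev = "\<lambda>f :: 'a \<Rightarrow> 'k. f a"
  have "?ev ` N \<subseteq> B" using insert.prems(2) by auto
  moreover have "submodule_over (*) B (?ev ` N)"
    unfolding submodule_over_def image_iff
  proof (intro conjI ballI, goal_cases)
    case 1
    show ?case using N(1) by (intro bexI[of _ 0]) auto
  next
    case (2 x y)
    then obtain f g where "f \<in> N" "g \<in> N" "x = f a" "y = g a" by blast
    then show ?case using N(2)[of f g] by (intro bexI[of _ "f + g"]) auto
  next
    case (3 b x)
    then obtain f where "f \<in> N" "x = f a" by blast
    then show ?case using N(3)[OF 3(1)] by (intro bexI[of _ "fun_scale b f"]) (auto simp: fun_scale_apply)
  qed
  ultimately obtain Z where Z: "Z \<subseteq> ?ev ` N" "finite Z" "?ev ` N \<subseteq> lincomb (*) B Z"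
    using assms(1) unfolding noetherian_def by metis
  then obtain Y1 where Y1: "Y1 \<subseteq> N" "finite Y1" "Z = ?ev ` Y1"
    by (metis finite_subset_image)
  let ?N0 = "{f \<in> N. f a = 0}"
  have N0: "submodule_over fun_scale B ?N0"
    using N by (auto simp: submodule_over_def fun_scale_apply)
  then obtain Y0 where Y0: "Y0 \<subseteq> ?N0" "finite Y0"
      "\<forall>f\<in>?N0. \<exists>g\<in>lincomb fun_scale B Y0. \<forall>a\<in>I. f a = g a"
    using insert.IH[OF N0] insert.prems(2) by blast
  have lift: "\<exists>g\<in>lincomb fun_scale B Y1. g a = b" if "b \<in> lincomb (*) B Z" for b
    using that unfolding Y1(3)
  proof (induction rule: lincomb.induct)
    case zero
    show ?case by (intro bexI[of _ 0]) (auto intro: lincomb.zero)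
  next
    case (step b x y)
    then obtain f g where "f \<in> Y1" "x = f a" "g \<in> lincomb fun_scale B Y1" "g a = y" by blast
    note fg = this
    then have "(fun_scale b f + g) a = b * x + y"
      by (simp add: fun_scale_apply)
    moreover have "fun_scale b f + g \<in> lincomb fun_scale B Y1"
      using fg step(1) by (intro lincomb.step)
    ultimately show ?case by (rule bexI)
  qed
  have "\<exists>g\<in>lincomb fun_scale B (Y0 \<union> Y1). \<forall>c\<in>insert a I. f c = g c" if f: "f \<in> N" for f
  proof -
    have "f a \<in> lincomb (*) B Z" using Z(3) f by auto
    then obtain g where g: "g \<in> lincomb fun_scale B Y1" "g a = f a"
      using lift by blast
    \<comment> \<open>\<open>g\<close> is a combination of lifted generators with the value of
      \<open>f\<close> at \<open>a\<close>, so \<open>f - g\<close> lies in the kernel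
      \<open>?N0\<close>.\<close>
    have "g \<in> N" using g(1) lincomb_subset[OF insert.prems(1) Y1(1)] by blast
    then have "f + fun_scale (-1) g \<in> N"
      using f is_subring_closed(2,3)[OF sub] by (intro N(2,3))
    then have "f + fun_scale (-1) g \<in> ?N0"
      using g(2) by (simp add: fun_scale_apply)
    then obtain h where h: "h \<in> lincomb fun_scale B Y0" "\<forall>a\<in>I. (f + fun_scale (-1) g) a = h a"
      using Y0(3) by blast
    have fh: "f c = h c + g c" if "c \<in> I" for c
      using h(2) that by (simp add: fun_scale_apply algebra_simps)
    \<comment> \<open>The correction \<open>h\<close> is built from kernel elements and does not
      disturb the value at \<open>a\<close>.\<close>
    have "h a = 0" using h(1) lincomb_subset[OF N0 Y0(1)] by blast
    moreover have "h + g \<in> lincomb fun_scale B (Y0 \<union> Y1)"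
      using subsetD[OF lincomb_mono h(1)] subsetD[OF lincomb_mono g(1)]
      by (intro lincomb_add) blast+
    ultimately show ?thesis
      using fh g(2) by (intro bexI[of _ "h + g"]) auto
  qed
  then show ?case
    using Y0(1,2) Y1(1,2) by (intro exI[of _ "Y0 \<union> Y1"]) auto
qed

text \<open>The last hypothesis speaks of all subrings containing \<open>E\<close>, because the
  noetherian one is chosen only inside the proof. It confines the values of \<open>F\<close> on
  \<open>I\<close> to that subring.\<close>

lemma finite_generating_subfamily:
  fixes F :: "'w \<Rightarrow> 'a \<Rightarrow> 'k::comm_ring_1"
  assumes "finite E" "finite I"
    and B: "\<And>B. is_subring B \<Longrightarrow> E \<subseteq> B \<Longrightarrow> \<forall>w. \<forall>a\<in>I. F w a \<in> B"
  shows "\<exists>W. finite W \<and> (\<forall>w. \<exists>c. \<forall>a\<in>I. F w a = (\<Sum>w'\<in>W. c w' * F w' a))"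
proof -
  obtain B where noeth: "noetherian B" and E: "E \<subseteq> B"
    using finite_subset_noetherian[OF assms(1)] by blast
  then have sub: "is_subring B" by (simp add: noetherian_def)
  let ?N = "lincomb fun_scale B (range F)"
  have N: "submodule_over fun_scale B ?N"
    by (rule module.submodule_over_lincomb[OF module_fun_scale sub])
  have "f a \<in> B" if "f \<in> ?N" "a \<in> I" for f a
    using that
    by (induction rule: lincomb.induct) (auto simp: fun_scale_apply intro!: is_subring_closed[OF sub] B[OF sub E, rule_format])
  then obtain Y where Y: "Y \<subseteq> ?N" "finite Y" "\<forall>f\<in>?N. \<exists>g\<in>lincomb fun_scale B Y. \<forall>a\<in>I. f a = g a"
    using noetherian_functions[OF noeth assms(2) N] by blast
  have "\<forall>y\<in>Y. \<exists>X. X \<subseteq> range F \<and> finite X \<and> y \<in> lincomb fun_scale B X"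
    using Y(1) lincomb_finite_subset by blast
  then obtain X where X: "\<And>y. y \<in> Y \<Longrightarrow> X y \<subseteq> range F" "\<And>y. y \<in> Y \<Longrightarrow> finite (X y)"
      "\<And>y. y \<in> Y \<Longrightarrow> y \<in> lincomb fun_scale B (X y)"
    by metis
  obtain W where W: "finite W" "(\<Union>y\<in>Y. X y) = F ` W" "inj_on F W"
    using X(1,2) Y(2) subset_image_inj[of "\<Union>y\<in>Y. X y" F UNIV]
    by (metis (no_types, lifting) UN_least finite_UN finite_image_iff)
  have "Y \<subseteq> lincomb fun_scale B (F ` W)"
    using X(3) W(2) lincomb_mono[of "X y" "F ` W" for y] by fastforce
  then have sub': "lincomb fun_scale B Y \<subseteq> lincomb fun_scale B (F ` W)"
    by (intro lincomb_subset module.submodule_over_lincomb[OF module_fun_scale sub])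
  have "\<exists>c. \<forall>a\<in>I. F w a = (\<Sum>w'\<in>W. c w' * F w' a)" for w
  proof -
    have "F w \<in> ?N" by (intro module.lincomb_base[OF module_fun_scale sub]) auto
    then obtain g where g: "g \<in> lincomb fun_scale B (F ` W)" "\<forall>a\<in>I. F w a = g a"
      using Y(3) sub' by blast
    obtain c where "g = (\<Sum>y\<in>F ` W. fun_scale (c y) y)"
      using lincomb_explicit[OF module_fun_scale finite_imageI[OF W(1)] g(1)] by blast
    then have g_eq: "g = (\<Sum>w'\<in>W. fun_scale (c (F w')) (F w'))"
      by (simp add: sum.reindex W(3))
    then have "g a = (\<Sum>w'\<in>W. c (F w') * F w' a)" for a
    proof -
      have "(sum H W) a = (\<Sum>w\<in>W. H w a)" for H :: "'w \<Rightarrow> 'a \<Rightarrow> 'k"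
        using W(1) by induction auto
      with g_eq show ?thesis by (simp add: fun_scale_apply)
    qed
    with g(2) show ?thesis by (intro exI[of _ "\<lambda>w'. c (F w')"]) simp
  qed
  with W(1) show ?thesis by blast
qed

section \<open>Linear independence of the Magnus images\<close>

abbreviation magnus :: "('n \<times> bool) list \<Rightarrow> ('k::comm_ring_1, 'n) ncfps" where
  "magnus u \<equiv> prod_list (map letter_to_nc u)"

text \<open>What stands to the left of a final \<open>x\<^sub>i\<close> in the words of
  \<open>r\<close>; the source of the Fox derivatives below.\<close>

definition right_shift :: "'n \<Rightarrow> ('k::comm_ring_1, 'n) ncfps \<Rightarrow> ('k, 'n) ncfps" where
  "right_shift i r = Abs_ncfps (\<lambda>w. nc_coeff r (w @ [i]))"

lemma nc_coeff_right_shift [simp]: "nc_coeff (right_shift i r) w = nc_coeff r (w @ [i])"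
  by (simp add: right_shift_def Abs_ncfps_inverse)

lemma nc_coeff_times_var_snoc:
  "nc_coeff (r * nc_var j) (w @ [i]) = (if i = j then nc_coeff r w else (0 :: 'k::comm_ring_1))"
proof -
  have "nc_coeff (r * nc_var j) (w @ [i]) =
      (\<Sum>k\<le>Suc (length w). nc_coeff r (take k (w @ [i])) * (if drop k (w @ [i]) = [j] then 1 else 0))"
    by (simp add: times_ncfps.rep_eq)
  also have "\<dots> = (\<Sum>k\<le>Suc (length w). if k = length w then (if i = j then nc_coeff r w else 0) else 0)"
  proof (rule sum.cong[OF refl])
    fix k assume "k \<in> {..Suc (length w)}"
    then consider "k < length w" | "k = length w" | "k = Suc (length w)" by fastforce
    then show "nc_coeff r (take k (w @ [i])) * (if drop k (w @ [i]) = [j] then 1 else 0) =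
        (if k = length w then (if i = j then nc_coeff r w else 0) else 0)"
      by cases (auto dest: arg_cong[of _ _ length])
  qed
  finally show ?thesis by (simp del: sum.atMost_Suc)
qed

lemma right_shift_simps:
  "right_shift i (f + g) = right_shift i f + right_shift i g"
  "right_shift i (nc_scale c f) = nc_scale c (right_shift i f)"
  "right_shift i 0 = 0" "right_shift i 1 = 0"
  "right_shift i (r * nc_var j) = (if i = j then r else 0)"
  by (rule ncfps_eqI; simp add: nc_coeff_times_var_snoc)+

lemma letter_to_nc_cancel: "r * letter_to_nc x * letter_to_nc (inv_letter x) = r"
  by (simp add: mult.assoc letter_to_nc_inv_letter)

lemma right_shift_letter:
  "right_shift i (r * letter_to_nc (j, True)) = right_shift i r + (if i = j then r else 0)"
  "right_shift i (r * letter_to_nc (j, False)) =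
     right_shift i r - (if i = j then r * letter_to_nc (j, False) else 0)"
proof -
  show pos: "right_shift i (r * letter_to_nc (j, True)) = right_shift i r + (if i = j then r else 0)" for r
    by (simp add: letter_to_nc_def distrib_left right_shift_simps)
  have "r * letter_to_nc (j, False) * letter_to_nc (j, True) = r"
    using letter_to_nc_cancel[of r "(j, False)"] by (simp add: inv_letter_def)
  with pos[of "r * letter_to_nc (j, False)"]
  show "right_shift i (r * letter_to_nc (j, False)) =
      right_shift i r - (if i = j then r * letter_to_nc (j, False) else 0)"
    by (simp add: algebra_simps)
qed

text \<open>Up to sign, the Fox derivative with respect to the generator \<open>x\<close>, where \<open>x\<close> may be an inverse letter.\<close>

definition fox :: "'n \<times> bool \<Rightarrow> ('k::comm_ring_1, 'n) ncfps \<Rightarrow> ('k, 'n) ncfps" where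
  "fox x r = right_shift (fst x) r * (if snd x then 1 else letter_to_nc (inv_letter x))"

lemma fox_simps:
  "fox x (f + g) = fox x f + fox x g" "fox x (nc_scale c f) = nc_scale c (fox x f)"
  "fox x 0 = 0" "fox x 1 = 0"
proof -
  interpret unital_algebra nc_scale by (rule unital_algebra_nc_scale)
  show "fox x (f + g) = fox x f + fox x g" "fox x (nc_scale c f) = nc_scale c (fox x f)"
    "fox x 0 = 0" "fox x 1 = 0"
    by (simp_all add: fox_def right_shift_simps distrib_right scale_mult_left)
qed

lemma fox_sum: "fox x (sum f A) = (\<Sum>a\<in>A. fox x (f a))"
  by (induction A rule: infinite_finite_induct) (simp_all add: fox_simps)

text \<open>The extra factor of \<open>fox\<close> for inverse letters makes both signs of
  \<open>x\<close> obey one rule: a final \<open>x\<close> contributes \<open>magnus u\<close>, a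
  final inverse of \<open>x\<close> contributes \<open>magnus (u @ [y])\<close> with the opposite
  sign.\<close>

lemma fox_snoc:
  "fox x (magnus (u @ [y]) :: ('k::comm_ring_1, 'n) ncfps) = fox x (magnus u) +
     nc_scale (if snd x then 1 else -1)
       ((if y = x then magnus u else 0) - (if y = inv_letter x then magnus (u @ [y]) else 0))"
proof -
  obtain i b where x: "x = (i, b)" by (cases x)
  obtain j c where y: "y = (j, c)" by (cases y)
  have cancel: "r * letter_to_nc (i, False) * letter_to_nc (i, True) = r" for r :: "('k, 'n) ncfps"
    using letter_to_nc_cancel[of r "(i, False)"] by (simp add: inv_letter_def)
  have scale: "nc_scale 1 r = r" "nc_scale (-1) r = - r" for r :: "('k, 'n) ncfps"
    by (auto intro!: ncfps_eqI)
  show ?thesis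
    by (cases b; cases c)
       (auto simp: x y fox_def inv_letter_def right_shift_letter scale cancel distrib_right left_diff_distrib)
qed

text \<open>The classical expansion of a Fox derivative as a signed sum over prefixes of
  \<open>u\<close>: those followed by \<open>x\<close>, minus those ending in the inverse of
  \<open>x\<close>.\<close>

definition fox_coeff :: "'n \<times> bool \<Rightarrow> ('n \<times> bool) list \<Rightarrow> ('n \<times> bool) list \<Rightarrow> 'k::comm_ring_1" where
  "fox_coeff x u h = (if prefix (h @ [x]) u then 1 else 0)
     - (if h \<noteq> [] \<and> last h = inv_letter x \<and> prefix h u then 1 else 0)"

text \<open>Allowing any finite \<open>T\<close> that contains the prefixes of \<open>u\<close>
  gives all words of a prefix-closed set one common index set, so that their expansions can be added
  termwise.\<close>

lemma fox_magnus:
  assumes "finite T" "\<And>v. prefix v u \<Longrightarrow> v \<in> T"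
  shows "fox x (magnus u :: ('k::comm_ring_1, 'n) ncfps) =
    nc_scale (if snd x then 1 else -1) (\<Sum>h\<in>T. nc_scale (fox_coeff x u h) (magnus h))"
  using assms(2)
proof (induction u rule: rev_induct)
  interpret unital_algebra nc_scale by (rule unital_algebra_nc_scale)
  {
    case Nil
    have "fox_coeff x [] h = (0 :: 'k)" for h
      by (auto simp: fox_coeff_def)
    then show ?case by (simp add: fox_simps)
  next
    case (snoc y u)
    \<comment> \<open>Appending \<open>y\<close> affects only two prefixes: \<open>u\<close>, which
      is now followed by \<open>y\<close>, and the new prefix \<open>u @ [y]\<close>.\<close>
    have "fox_coeff x (u @ [y]) h = fox_coeff x u h +
        (if h = u then (if y = x then 1 else 0) else 0) -
        (if h = u @ [y] then (if y = inv_letter x then 1 else (0 :: 'k)) else 0)" for h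
      by (auto simp: fox_coeff_def prefix_snoc dest: prefix_length_le)
    then have "(\<Sum>h\<in>T. nc_scale (fox_coeff x (u @ [y]) h) (magnus h :: ('k, 'n) ncfps)) =
        (\<Sum>h\<in>T. nc_scale (fox_coeff x u h) (magnus h)) +
        (\<Sum>h\<in>T. if h = u then (if y = x then magnus u else 0) else 0) -
        (\<Sum>h\<in>T. if h = u @ [y] then (if y = inv_letter x then magnus (u @ [y]) else 0) else 0)"
      unfolding sum.distrib[symmetric] sum_subtractf[symmetric]
      by (intro sum.cong) (auto simp: scale_left_distrib scale_left_diff_distrib)
    moreover have "u \<in> T" "u @ [y] \<in> T"
      using snoc.prems by auto
    ultimately have sum_eq: "(\<Sum>h\<in>T. nc_scale (fox_coeff x (u @ [y]) h) (magnus h :: ('k, 'n) ncfps)) =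
        (\<Sum>h\<in>T. nc_scale (fox_coeff x u h) (magnus h)) + (if y = x then magnus u else 0) -
        (if y = inv_letter x then magnus (u @ [y]) else 0)"
      using assms(1) by simp
    have IH: "fox x (magnus u :: ('k, 'n) ncfps) =
        nc_scale (if snd x then 1 else -1) (\<Sum>h\<in>T. nc_scale (fox_coeff x u h) (magnus h))"
      using snoc.prems by (intro snoc.IH) (auto simp: prefix_snoc)
    show ?case
      unfolding fox_snoc IH sum_eq by (simp only: scale_right_distrib[symmetric] add_diff_eq)
  }
qed

text \<open>Remove a longest word \<open>w = w' @ [x]\<close> of \<open>T\<close>. Applying \<open>fox x\<close> to the relation gives one without the
  term of \<open>w\<close>, in which the coefficient of \<open>w'\<close> is that of \<open>w\<close> in the original relation.\<close>

lemma magnus_independent: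
  fixes c :: "('n \<times> bool) list \<Rightarrow> 'k::comm_ring_1"
  assumes "finite T" "\<And>u v. u \<in> T \<Longrightarrow> prefix v u \<Longrightarrow> v \<in> T" "\<And>u. u \<in> T \<Longrightarrow> reduced u"
    "(\<Sum>u\<in>T. nc_scale (c u) (magnus u)) = 0"
  shows "\<forall>u\<in>T. c u = 0"
  using assms
proof (induction "card T" arbitrary: T c)
  case 0
  then show ?case by simp
next
  case (Suc m)
  interpret unital_algebra "nc_scale :: 'k \<Rightarrow> ('k, 'n) ncfps \<Rightarrow> _" by (rule unital_algebra_nc_scale)
  obtain w where w: "w \<in> T" "\<And>u. u \<in> T \<Longrightarrow> length u \<le> length w"
  proof -
    have "T \<noteq> {}" using Suc.hyps(2) by auto
    then have "Max (length ` T) \<in> length ` T" using Suc.prems(1) by (intro Max_in) auto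
    then obtain w where "w \<in> T" "length w = Max (length ` T)" by auto
    with Suc.prems(1) show ?thesis by (intro that[of w]) auto
  qed
  let ?T = "T - {w}"
  have card: "m = card ?T" and fin: "finite ?T" using Suc.hyps(2) Suc.prems(1) w(1) by auto
  \<comment> \<open>A longest word is not a proper prefix of another word of \<open>T\<close>, so
    its removal keeps the set prefix-closed.\<close>
  have closed: "v \<in> ?T" if "u \<in> ?T" "prefix v u" for u v
    using that Suc.prems(2) w(2)[of u] by (auto simp: prefix_def)
  have red: "\<And>u. u \<in> ?T \<Longrightarrow> reduced u" using Suc.prems(3) by auto
  have IH: "\<forall>u\<in>?T. b u = 0" if "(\<Sum>u\<in>?T. nc_scale (b u) (magnus u :: ('k, 'n) ncfps)) = 0" for b
    using closed red by (intro Suc.hyps(1)[OF card fin _ _ that]) blast+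
  have cw: "c w = 0"
  proof (cases w rule: rev_cases)
    case Nil
    then have "T = {[]}" using w by auto
    then have "nc_coeff (nc_scale (c []) (1 :: ('k, 'n) ncfps)) [] = nc_coeff 0 []"
      using Suc.prems(4) by simp
    then show ?thesis using Nil by simp
  next
    case (snoc w' x)
    define d where "d h = (\<Sum>u\<in>T. c u * fox_coeff x u h)" for h
    have "fox x (\<Sum>u\<in>T. nc_scale (c u) (magnus u)) =
        (\<Sum>u\<in>T. nc_scale (if snd x then 1 else -1)
           (\<Sum>h\<in>T. nc_scale (c u * fox_coeff x u h) (magnus h)))"
      unfolding fox_sum fox_simps
      using Suc.prems(1,2)
      by (intro sum.cong refl)
         (simp add: fox_magnus[of T] scale_sum_right mult.left_commute mult.commute)
    also have "\<dots> = nc_scale (if snd x then 1 else -1) (\<Sum>h\<in>T. nc_scale (d h) (magnus h))"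
      unfolding d_def scale_sum_left scale_sum_right[symmetric] by (subst sum.swap) simp
    finally have "nc_scale (if snd x then 1 else -1) (\<Sum>h\<in>T. nc_scale (d h) (magnus h)) = 0"
      using Suc.prems(4) by (simp add: fox_simps)
    then have rel: "(\<Sum>h\<in>T. nc_scale (d h) (magnus h)) = 0"
      by (auto split: if_splits)
    have inv: "inv_letter x \<noteq> x" by (auto simp: inv_letter_def prod_eq_iff)
    have noprefix: "\<not> prefix (w @ [x]) u" if "u \<in> T" for u
      using w(2)[OF that] by (auto dest: prefix_length_le)
    \<comment> \<open>No word of \<open>T\<close> extends the longest word \<open>w\<close>, and
      \<open>w\<close> ends in \<open>x\<close> rather than in its inverse; so both parts of
      \<open>fox_coeff\<close> vanish.\<close>
    have "d w = 0"
      unfolding d_def using noprefix inv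
      by (intro sum.neutral ballI) (auto simp: fox_coeff_def snoc)
    then have "(\<Sum>h\<in>?T. nc_scale (d h) (magnus h)) = 0"
      using rel w(1) Suc.prems(1) by (simp add: sum.remove)
    moreover have w': "w' \<in> ?T" using w(1) Suc.prems(2)[of w w'] by (auto simp: snoc)
    ultimately have "d w' = 0" using IH[of d] by blast
    \<comment> \<open>By maximality of its length, \<open>w\<close> is the only word of
      \<open>T\<close> with prefix \<open>w' @ [x]\<close>; and \<open>w'\<close> does not end in
      the inverse of \<open>x\<close>, because \<open>w\<close> is reduced.\<close>
    moreover have "d w' = (\<Sum>u\<in>T. if u = w then c w else 0)"
      unfolding d_def
    proof (intro sum.cong refl)
      fix u assume u: "u \<in> T"
      have "w' \<noteq> [] \<Longrightarrow> last w' \<noteq> inv_letter x"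
        using Suc.prems(3)[OF w(1)] by (auto simp: snoc reduced_def successively_append_iff)
      moreover have "prefix (w' @ [x]) u \<longleftrightarrow> u = w"
        using w(2)[OF u] by (auto simp: snoc prefix_def)
      ultimately show "c u * fox_coeff x u w' = (if u = w then c w else 0)"
        by (auto simp: fox_coeff_def)
    qed
    ultimately show ?thesis using w(1) Suc.prems(1) by simp
  qed
  then have "(\<Sum>u\<in>?T. nc_scale (c u) (magnus u)) = 0"
    using Suc.prems(1,4) w(1) by (simp add: sum.remove)
  with IH cw show ?case by blast
qed

lemma reduced_prefix: "reduced u \<Longrightarrow> prefix v u \<Longrightarrow> reduced v"
  by (auto simp: reduced_def prefix_def successively_append_iff)

lemma inj_fga_to_nc: "inj (fga_to_nc :: ('k::comm_ring_1, 'n) free_group_algebra \<Rightarrow> _)"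
proof (rule injI)
  interpret unital_algebra "nc_scale :: 'k \<Rightarrow> ('k, 'n) ncfps \<Rightarrow> _" by (rule unital_algebra_nc_scale)
  fix p q :: "('k, 'n) free_group_algebra" assume eq: "fga_to_nc p = fga_to_nc q"
  define r where "r = p - q"
  have zero: "fga_to_nc r = 0"
    using eq by (simp add: r_def algebra_homD(9)[OF algebra_hom_fga_to_nc])
  let ?K = "reduced_word ` Poly_Mapping.keys r"
  \<comment> \<open>\<open>magnus_independent\<close> requires a prefix-closed set, so the support
    is closed under prefixes; the words added get coefficient zero.\<close>
  let ?T = "\<Union>u\<in>?K. {v. prefix v u}"
  let ?c = "\<lambda>u. Poly_Mapping.lookup r (Abs_free_group u)"
  have fin: "finite ?T" by (auto simp flip: set_prefixes_eq)
  have red: "reduced u" if "u \<in> ?T" for u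
    using that reduced_prefix reduced_word by auto
  have "(\<Sum>u\<in>?T. nc_scale (?c u) (magnus u)) = (\<Sum>u\<in>?K. nc_scale (?c u) (magnus u))"
  proof (rule sum.mono_neutral_right[OF fin])
    show "\<forall>u\<in>?T - ?K. nc_scale (?c u) (magnus u) = 0"
    proof
      fix u assume u: "u \<in> ?T - ?K"
      then have "reduced_word (Abs_free_group u) = u"
        using red by (simp add: Abs_free_group_inverse)
      then have "Abs_free_group u \<notin> Poly_Mapping.keys r"
        using u by (metis DiffD2 image_eqI)
      then show "nc_scale (?c u) (magnus u) = 0"
        by (simp add: not_in_keys_iff_lookup_eq_zero)
    qed
  qed auto
  also have "\<dots> = (\<Sum>g\<in>Poly_Mapping.keys r. nc_scale (Poly_Mapping.lookup r g) (fg_to_nc g))"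
    by (subst sum.reindex) (auto simp: inj_on_def reduced_word_inject reduced_word_inverse fg_to_nc_def)
  also have "\<dots> = 0" using zero by (simp add: fga_to_nc_def)
  finally have "\<forall>u\<in>?T. ?c u = 0"
    using red by (intro magnus_independent[OF fin]) (auto intro: prefix_order.trans)
  then have "?c (reduced_word g) = 0" if "g \<in> Poly_Mapping.keys r" for g
    using that by blast
  then have "Poly_Mapping.lookup r g = 0" for g
    by (cases "g \<in> Poly_Mapping.keys r")
       (simp_all add: reduced_word_inverse not_in_keys_iff_lookup_eq_zero)
  then have "r = 0" by (intro poly_mapping_eqI) simp
  then show "p = q" by (simp add: r_def)
qed

section \<open>Matrices over the rational closure\<close>

text \<open>Gaussian elimination: the pivots are \<open>1 - q\<close> with \<open>q\<close> having zero constant term.\<close>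

lemma ncrat_linear_system:
  fixes Q :: "'a \<Rightarrow> 'a \<Rightarrow> ('k::comm_ring_1, 'n) ncrat"
  assumes "finite I" "\<And>a b. a \<in> I \<Longrightarrow> b \<in> I \<Longrightarrow> nc_coeff (nc_of_rat (Q a b)) [] = 0"
  shows "\<exists>y. \<forall>a\<in>I. y a = c a + (\<Sum>b\<in>I. Q a b * y b)"
  using assms
proof (induction I arbitrary: Q c)
  case (insert a I)
  obtain p where p: "(1 - Q a a) * (1 + p) = 1"
    using ncrat_one_minus_invertible[OF insert.prems(1)[of a a]] by blast
  define u where "u = 1 + p"
  \<comment> \<open>Eliminating the unknown
    \<open>y a = u * (c a + \<Sum>b\<in>I. Q a b * y b)\<close>, with \<open>u\<close> the inverse
    of the pivot, leaves this system on \<open>I\<close>. Its entries again have zero constant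
    term.\<close>
  obtain y where y: "\<forall>b\<in>I. y b = (c b + Q b a * (u * c a)) + (\<Sum>b'\<in>I. (Q b b' + Q b a * (u * Q a b')) * y b')"
    using insert.IH[of "\<lambda>b b'. Q b b' + Q b a * (u * Q a b')" "\<lambda>b. c b + Q b a * (u * c a)"] insert.prems
    by auto
  define s where "s = c a + (\<Sum>b\<in>I. Q a b * y b)"
  define z where "z = y(a := u * s)"
  have zI: "z b = y b" if "b \<in> I" for b using that insert.hyps by (auto simp: z_def)
  have sumI: "(\<Sum>b'\<in>I. Q b b' * z b') = (\<Sum>b'\<in>I. Q b b' * y b')" for b
    by (intro sum.cong) (auto simp: zI)
  have "z b = c b + (\<Sum>b'\<in>insert a I. Q b b' * z b')" if "b \<in> insert a I" for b
  proof (cases "b = a")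
    case True
    have za: "z a = u * s" by (simp add: z_def)
    have "z b = Q a a * z a + (1 - Q a a) * (u * s)"
      by (simp add: True za algebra_simps)
    also have "(1 - Q a a) * (u * s) = s"
      using p by (simp add: u_def flip: mult.assoc)
    also have "Q a a * z a + s = c b + (\<Sum>b'\<in>insert a I. Q b b' * z b')"
      using insert.hyps by (simp add: True sumI s_def add_ac)
    finally show ?thesis .
  next
    case False
    then have b: "b \<in> I" using that by auto
    have "z b = (c b + Q b a * (u * c a)) + (\<Sum>b'\<in>I. (Q b b' + Q b a * (u * Q a b')) * y b')"
      unfolding zI[OF b] using y b by blast
    also have "\<dots> = c b + Q b a * (u * s) + (\<Sum>b'\<in>I. Q b b' * y b')"
      by (simp add: s_def distrib_left distrib_right sum.distrib sum_distrib_left mult.assoc add_ac)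
    also have "\<dots> = c b + (\<Sum>b'\<in>insert a I. Q b b' * z b')"
      using insert.hyps by (simp add: sumI) (simp add: z_def add_ac)
    finally show ?thesis .
  qed
  then show ?case by blast
qed simp

text \<open>The columns of \<open>Q'\<close> solve linear systems with the columns of
  \<open>- Q\<close> on the right. The right inverse is kept in the form \<open>1 + Q'\<close> with
  zero constant terms so that the lemma applies to it again.\<close>

lemma ncrat_right_inverse:
  fixes Q :: "('k::comm_ring_1, 'n) ncrat mat"
  assumes Q: "Q \<in> carrier_mat l l" "\<And>a b. a < l \<Longrightarrow> b < l \<Longrightarrow> nc_coeff (nc_of_rat (Q $$ (a, b))) [] = 0"
  shows "\<exists>Q'\<in>carrier_mat l l. (\<forall>a<l. \<forall>b<l. nc_coeff (nc_of_rat (Q' $$ (a, b))) [] = 0) \<and>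
    (1\<^sub>m l + Q) * (1\<^sub>m l + Q') = 1\<^sub>m l"
proof -
  have "\<exists>y. \<forall>a\<in>{..<l}. y a = - Q $$ (a, k) + (\<Sum>b<l. (- Q $$ (a, b)) * y b)" if "k < l" for k
    using Q that by (intro ncrat_linear_system) auto
  then have "\<forall>k. \<exists>y. k < l \<longrightarrow> (\<forall>a\<in>{..<l}. y a = - Q $$ (a, k) + (\<Sum>b<l. (- Q $$ (a, b)) * y b))"
    by blast
  from choice[OF this] obtain y
    where y: "\<And>k a. k < l \<Longrightarrow> a < l \<Longrightarrow> y k a = - Q $$ (a, k) + (\<Sum>b<l. (- Q $$ (a, b)) * y k b)"
    by blast
  define Q' where "Q' = mat l l (\<lambda>(a, k). y k a)"
  have Q': "Q' \<in> carrier_mat l l" by (simp add: Q'_def)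
  have entry: "Q' $$ (a, k) + Q $$ (a, k) + (\<Sum>b<l. Q $$ (a, b) * Q' $$ (b, k)) = 0" if "a < l" "k < l" for a k
    using y[OF that(2,1)] that by (simp add: Q'_def sum_negf)
  have "(1\<^sub>m l + Q) * (1\<^sub>m l + Q') = 1\<^sub>m l + Q' + (Q + Q * Q')"
    using add_mult_distrib_mat[OF one_carrier_mat Q(1) add_carrier_mat[OF Q', of "1\<^sub>m l"]]
      mult_add_distrib_mat[OF Q(1) one_carrier_mat Q'] left_mult_one_mat[OF add_carrier_mat[OF Q', of "1\<^sub>m l"]]
      right_mult_one_mat[OF Q(1)] by simp
  also have "\<dots> = 1\<^sub>m l"
    using Q(1) Q' entry
    by (intro eq_matI) (auto simp: scalar_prod_def atLeast0LessThan add_ac)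
  finally have "(1\<^sub>m l + Q) * (1\<^sub>m l + Q') = 1\<^sub>m l" .
  moreover have "nc_coeff (nc_of_rat (Q' $$ (a, b))) [] = 0" if "a < l" "b < l" for a b
    using y[OF that(2,1)] that Q(2) by (simp add: Q'_def)
  ultimately show ?thesis using Q' by blast
qed

text \<open>The right inverse \<open>1 + Q'\<close> has a right inverse of its own, which by
  associativity must be \<open>1 + Q\<close>; so \<open>1 + Q'\<close> is a two-sided
  inverse.\<close>

lemma ncrat_one_plus_invertible:
  fixes Q :: "('k::comm_ring_1, 'n) ncrat mat"
  assumes Q: "Q \<in> carrier_mat l l" "\<And>a b. a < l \<Longrightarrow> b < l \<Longrightarrow> nc_coeff (nc_of_rat (Q $$ (a, b))) [] = 0"
  shows "invertible_matrix (1\<^sub>m l + Q)"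
proof -
  obtain Q' where Q': "Q' \<in> carrier_mat l l" "\<forall>a<l. \<forall>b<l. nc_coeff (nc_of_rat (Q' $$ (a, b))) [] = 0"
      "(1\<^sub>m l + Q) * (1\<^sub>m l + Q') = 1\<^sub>m l"
    using ncrat_right_inverse[OF Q] by blast
  obtain Q'' where Q'': "Q'' \<in> carrier_mat l l" "(1\<^sub>m l + Q') * (1\<^sub>m l + Q'') = 1\<^sub>m l"
    using ncrat_right_inverse[of Q' l] Q' by blast
  let ?M = "1\<^sub>m l + Q" and ?N = "1\<^sub>m l + Q'" and ?L = "1\<^sub>m l + Q''"
  have car: "?M \<in> carrier_mat l l" "?N \<in> carrier_mat l l" "?L \<in> carrier_mat l l"
    using Q(1) Q'(1) Q''(1) by auto
  have "?M = ?M * (?N * ?L)" using right_mult_one_mat[OF car(1)] Q''(2) by simp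
  also have "\<dots> = ?L" using Q'(3) car left_mult_one_mat[OF car(3)] by (simp flip: assoc_mult_mat[of _ l l _ l _ l])
  finally have "?N * ?M = 1\<^sub>m l" using Q''(2) by simp
  with Q'(3) show ?thesis
    unfolding invertible_matrix_def using Q(1) Q'(1) by (intro conjI exI[of _ ?N]) auto
qed

lemma inverting_ncrat:
  fixes j :: "'r::{ring,monoid_mult} \<Rightarrow> ('k::comm_ring_1, 'n) ncrat"
  assumes "algebra_hom s ncrat_scale j" "\<And>p. p \<in> I \<Longrightarrow> nc_coeff (nc_of_rat (j p)) [] = 0"
  shows "inverting (one_plus_matrices I) j"
  unfolding inverting_def
proof
  fix M assume "M \<in> one_plus_matrices I"
  then obtain l Q where M: "M = 1\<^sub>m l + Q" "Q \<in> carrier_mat l l" "elements_mat Q \<subseteq> I"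
    by (auto simp: one_plus_matrices_def)
  have "map_mat j M = 1\<^sub>m l + map_mat j Q"
    using M by (intro eq_matI) (auto simp: algebra_homD[OF assms(1)])
  moreover have "invertible_matrix (1\<^sub>m l + map_mat j Q)"
  proof (rule ncrat_one_plus_invertible)
    fix a b assume "a < l" "b < l"
    then have "Q $$ (a, b) \<in> I" using M(3) elements_matI[OF M(2)] by blast
    then show "nc_coeff (nc_of_rat (map_mat j Q $$ (a, b))) [] = 0"
      using assms(2) M(2) \<open>a < l\<close> \<open>b < l\<close> by simp
  qed (use M in auto)
  ultimately show "invertible_matrix (map_mat j M)" by simp
qed

lemma inverting_fa_to_ncrat: "inverting (one_plus_matrices fa_aug) (fa_to_ncrat :: ('k::comm_ring_1, 'n::finite) free_algebra \<Rightarrow> _)"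
  by (rule inverting_ncrat[OF algebra_hom_fa_to_ncrat])
     (auto simp: fa_aug_def left_span_def algebra_homD[OF algebra_hom_fa_to_nc])

lemma inverting_fga_to_ncrat: "inverting (one_plus_matrices fga_aug) (fga_to_ncrat :: ('k::comm_ring_1, 'n::finite) free_group_algebra \<Rightarrow> _)"
  by (rule inverting_ncrat[OF algebra_hom_fga_to_ncrat])
     (auto simp: fga_aug_def left_span_def algebra_homD[OF algebra_hom_fga_to_nc])

section \<open>Linear systems over an inverting algebra\<close>

lemma invertible_matrix_solve:
  fixes M :: "'s::{ring,monoid_mult} mat"
  assumes M: "M \<in> carrier_mat l l" "invertible_matrix M"
  shows "\<exists>z. \<forall>i<l. (\<Sum>j<l. M $$ (i, j) * z j) = c i"
    and "(\<And>i. i < l \<Longrightarrow> (\<Sum>j<l. M $$ (i, j) * z j) = 0) \<Longrightarrow> i < l \<Longrightarrow> z i = 0"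
proof -
  obtain N where N: "M * N = 1\<^sub>m (dim_row M)" "N * M = 1\<^sub>m (dim_row N)"
    using M(2) by (auto simp: invertible_matrix_def)
  have dims: "dim_row M = l" "dim_col M = l" using M(1) by auto
  have dimc: "dim_col N = l" using arg_cong[OF N(1), of dim_col] dims by simp
  have dimr: "dim_row N = l" using arg_cong[OF N(2), of dim_col] dims by simp
  have prod: "(\<Sum>j<l. (\<Sum>k<l. A $$ (i, k) * B $$ (k, j)) * c j) = c i"
    if "A * B = 1\<^sub>m l" "A \<in> carrier_mat l l" "B \<in> carrier_mat l l" "i < l" for A B :: "'s mat" and c i
  proof -
    have "(\<Sum>k<l. A $$ (i, k) * B $$ (k, j)) = (if i = j then 1 else 0)" if "j < l" for j
      using arg_cong[OF \<open>A * B = 1\<^sub>m l\<close>, of "\<lambda>X. X $$ (i, j)"] that \<open>i < l\<close> \<open>A \<in> _\<close> \<open>B \<in> _\<close>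
      by (simp add: scalar_prod_def atLeast0LessThan)
    then have "(\<Sum>j<l. (\<Sum>k<l. A $$ (i, k) * B $$ (k, j)) * c j) = (\<Sum>j<l. if i = j then c j else 0)"
      by (intro sum.cong) auto
    then show ?thesis using that by simp
  qed
  have swap: "(\<Sum>j<l. A $$ (i, j) * (\<Sum>k<l. B $$ (j, k) * c k)) =
      (\<Sum>j<l. (\<Sum>k<l. A $$ (i, k) * B $$ (k, j)) * c j)" for A B :: "'s mat" and c i
    by (simp add: sum_distrib_left sum_distrib_right mult.assoc) (rule sum.swap)
  have N': "N \<in> carrier_mat l l" using dimr dimc by auto
  have MN: "M * N = 1\<^sub>m l" "N * M = 1\<^sub>m l" using N dims dimr by simp_all
  show "\<exists>z. \<forall>i<l. (\<Sum>j<l. M $$ (i, j) * z j) = c i"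
    using prod[OF MN(1) M(1) N'] by (intro exI[of _ "\<lambda>j. \<Sum>k<l. N $$ (j, k) * c k"]) (simp add: swap)
  show "z i = 0" if "\<And>i. i < l \<Longrightarrow> (\<Sum>j<l. M $$ (i, j) * z j) = 0" "i < l"
    using prod[OF MN(2) N' M(1) that(2), of z] that(1) by (simp flip: swap)
qed

text \<open>Surjectivity and injectivity of the inverted matrix
  \<open>1 - \<Sum>i. x\<^sub>i Q\<^sub>i\<close>. The construction of the extension uses the
  inversion hypothesis on \<open>f\<close> only through these two facts.\<close>

lemma inverting_linear_system:
  fixes Q :: "'n::finite \<Rightarrow> 'a \<Rightarrow> 'a \<Rightarrow> 'k::comm_ring_1" and v :: "'a \<Rightarrow> 's::{ring,monoid_mult}"
  assumes hom: "algebra_hom pm_scale s f" and inv: "inverting (one_plus_matrices fa_aug) f"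
    and fin: "finite I"
  shows "\<exists>z. \<forall>a\<in>I. z a = v a + (\<Sum>i\<in>UNIV. f (fa_var i) * (\<Sum>b\<in>I. s (Q i a b) (z b)))"
    and "(\<And>a. a \<in> I \<Longrightarrow> z a = (\<Sum>i\<in>UNIV. f (fa_var i) * (\<Sum>b\<in>I. s (Q i a b) (z b)))) \<Longrightarrow> a \<in> I \<Longrightarrow> z a = 0"
proof -
  interpret unital_algebra s using algebra_homD(2)[OF hom] .
  note fD = algebra_homD[OF hom]
  show "\<exists>z. \<forall>a\<in>I. z a = v a + (\<Sum>i\<in>UNIV. f (fa_var i) * (\<Sum>b\<in>I. s (Q i a b) (z b)))"
    and "(\<And>a. a \<in> I \<Longrightarrow> z a = (\<Sum>i\<in>UNIV. f (fa_var i) * (\<Sum>b\<in>I. s (Q i a b) (z b)))) \<Longrightarrow> a \<in> I \<Longrightarrow> z a = 0" for z a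
  proof -
    obtain e and l :: nat where e: "bij_betw e {..<l} I"
      using ex_bij_betw_nat_finite[OF fin] unfolding atLeast0LessThan by blast
    \<comment> \<open>The sign turns \<open>1 - \<Sum>i. x\<^sub>i Q\<^sub>i\<close> into
      \<open>1 + q\<close>; scalar coefficients to the left of the variables place the entries in
      the left span \<open>fa_aug\<close>. The bijection \<open>e\<close> numbers the
      unknowns.\<close>
    define q where "q a b = - (\<Sum>i\<in>UNIV. pm_scale (Q i (e a) (e b)) (fa_var i))" for a b
    define M where "M = 1\<^sub>m l + mat l l (\<lambda>(a, b). q a b)"
    have q_aug: "q a b \<in> fa_aug" for a b
    proof -
      have "q a b = (\<Sum>i\<in>UNIV. (- Poly_Mapping.single 0 (Q i (e a) (e b))) * fa_var i)"
        by (simp add: q_def pm_scale_eq sum_negf)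
      then show ?thesis
        unfolding fa_aug_def left_span_def
        by (intro CollectI exI[of _ "\<lambda>i. - Poly_Mapping.single 0 (Q i (e a) (e b))"] conjI TrueI)
    qed
    have f_q: "f (q a b) = - (\<Sum>i\<in>UNIV. s (Q i (e a) (e b)) (f (fa_var i)))" for a b
      by (simp add: q_def fD)
    have system: "(\<Sum>b<l. map_mat f M $$ (a, b) * z (e b)) =
        z (e a) - (\<Sum>i\<in>UNIV. f (fa_var i) * (\<Sum>b\<in>I. s (Q i (e a) b) (z b)))" if "a < l" for a z
    proof -
      have "(\<Sum>b<l. map_mat f M $$ (a, b) * z (e b)) =
          (\<Sum>b<l. (if b = a then z (e b) else 0) - (\<Sum>i\<in>UNIV. f (fa_var i) * s (Q i (e a) (e b)) (z (e b))))"
      proof (intro sum.cong refl)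
        fix b assume "b \<in> {..<l}"
        then have "map_mat f M $$ (a, b) = (if b = a then 1 else 0) + f (q a b)"
          using that by (simp add: M_def fD)
        then show "map_mat f M $$ (a, b) * z (e b) =
            (if b = a then z (e b) else 0) - (\<Sum>i\<in>UNIV. f (fa_var i) * s (Q i (e a) (e b)) (z (e b)))"
          by (simp add: f_q distrib_right left_diff_distrib sum_distrib_right scale_mult_left scale_mult_right)
      qed
      also have "\<dots> = z (e a) - (\<Sum>b<l. \<Sum>i\<in>UNIV. f (fa_var i) * s (Q i (e a) (e b)) (z (e b)))"
        using that by (simp add: sum_subtractf)
      also have "(\<Sum>b<l. \<Sum>i\<in>UNIV. f (fa_var i) * s (Q i (e a) (e b)) (z (e b))) =
          (\<Sum>i\<in>UNIV. f (fa_var i) * (\<Sum>b<l. s (Q i (e a) (e b)) (z (e b))))"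
        by (subst sum.swap) (simp add: sum_distrib_left)
      also have "\<dots> = (\<Sum>i\<in>UNIV. f (fa_var i) * (\<Sum>b\<in>I. s (Q i (e a) b) (z b)))"
        by (intro sum.cong refl arg_cong2[of _ _ _ _ "(*)"] sum.reindex_bij_betw[OF e])
      finally show ?thesis .
    qed
    have car: "map_mat f M \<in> carrier_mat l l" by (simp add: M_def)
    have invM: "invertible_matrix (map_mat f M)" if "l \<ge> 1"
    proof -
      have "M \<in> one_plus_matrices fa_aug"
        unfolding one_plus_matrices_def M_def using that q_aug
        by (auto intro!: exI[of _ l] exI[of _ "mat l l (\<lambda>(a, b). q a b)"] simp: elements_mat_def)
      then show ?thesis using inv by (auto simp: inverting_def)
    qed
    have onto: "\<exists>i<l. a = e i" if "a \<in> I" for a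
      using e that by (auto simp: bij_betw_def)
    show "\<exists>z. \<forall>a\<in>I. z a = v a + (\<Sum>i\<in>UNIV. f (fa_var i) * (\<Sum>b\<in>I. s (Q i a b) (z b)))"
    \<comment> \<open>\<open>one_plus_matrices\<close> contains no matrices of size zero, so the
      empty system is treated apart.\<close>
    proof (cases "l \<ge> 1")
      case True
      obtain z where z: "\<forall>i<l. (\<Sum>j<l. map_mat f M $$ (i, j) * z j) = v (e i)"
        using invertible_matrix_solve(1)[OF car invM[OF True], of "\<lambda>i. v (e i)"] by (elim exE) blast
      let ?z = "z \<circ> inv_into {..<l} e"
      have ze: "?z (e j) = z j" if "j < l" for j
        using e that by (simp add: bij_betw_def inv_into_f_f)
      have "?z (e a) = v (e a) + (\<Sum>i\<in>UNIV. f (fa_var i) * (\<Sum>b\<in>I. s (Q i (e a) b) (?z b)))" if "a < l" for a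
      proof -
        have "(\<Sum>b<l. map_mat f M $$ (a, b) * ?z (e b)) = v (e a)"
          using z that by (simp add: ze del: comp_apply)
        then show ?thesis by (simp only: system[OF that] diff_eq_eq)
      qed
      then show ?thesis using onto by (intro exI[of _ ?z]) blast
    next
      case False
      then have "l = 0" by simp
      then have "I = {}" using e by (auto simp: bij_betw_def)
      then show ?thesis by simp
    qed
    assume homogeneous: "\<And>a. a \<in> I \<Longrightarrow> z a = (\<Sum>i\<in>UNIV. f (fa_var i) * (\<Sum>b\<in>I. s (Q i a b) (z b)))"
      and "a \<in> I"
    then obtain k where k: "k < l" "a = e k" using onto by blast
    have "(\<Sum>j<l. map_mat f M $$ (i, j) * z (e j)) = 0" if "i < l" for i
    proof -
      have "e i \<in> I" using e that by (auto simp: bij_betw_def)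
      from homogeneous[OF this] show ?thesis by (simp only: system[OF that] right_minus_eq)
    qed
    moreover have "l \<ge> 1" using k by simp
    ultimately have "z (e k) = 0"
      using invertible_matrix_solve(2)[OF car invM, of "\<lambda>j. z (e j)"] k(1) by blast
    then show "z a = 0" by (simp add: k(2))
  qed
qed

section \<open>Product algebras\<close>

instantiation prod :: (times, times) times
begin
definition times_prod_def: "x * y = (fst x * fst y, snd x * snd y)"
instance ..
end

instantiation prod :: (one, one) one
begin
definition one_prod_def: "1 = (1, 1)"
instance ..
end

lemma fst_times [simp]: "fst (x * y) = fst x * fst y"
  and snd_times [simp]: "snd (x * y) = snd x * snd y"
  and fst_one [simp]: "fst 1 = 1"
  and snd_one [simp]: "snd 1 = 1"
  by (simp_all add: times_prod_def one_prod_def)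

instance prod :: (semigroup_mult, semigroup_mult) semigroup_mult
  by standard (simp add: prod_eq_iff mult.assoc)

instance prod :: (ring, ring) ring
  by standard (simp_all add: prod_eq_iff algebra_simps)

instance prod :: (monoid_mult, monoid_mult) monoid_mult
  by standard (simp_all add: prod_eq_iff)

definition pair_scale :: "('k \<Rightarrow> 'a \<Rightarrow> 'a) \<Rightarrow> ('k \<Rightarrow> 'b \<Rightarrow> 'b) \<Rightarrow> 'k \<Rightarrow> 'a \<times> 'b \<Rightarrow> 'a \<times> 'b" where
  "pair_scale s t c x = (s c (fst x), t c (snd x))"

lemma pair_scale_simps [simp]:
  "fst (pair_scale s t c x) = s c (fst x)" "snd (pair_scale s t c x) = t c (snd x)"
  by (simp_all add: pair_scale_def)

lemma fst_sum: "fst (sum f A) = (\<Sum>a\<in>A. fst (f a))"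
  by (induction A rule: infinite_finite_induct) simp_all

lemma snd_sum: "snd (sum f A) = (\<Sum>a\<in>A. snd (f a))"
  by (induction A rule: infinite_finite_induct) simp_all

lemma unital_algebra_pair_scale:
  assumes "unital_algebra s" "unital_algebra t"
  shows "unital_algebra (pair_scale s t)"
proof -
  interpret s: unital_algebra s by fact
  interpret t: unital_algebra t by fact
  show ?thesis
    by unfold_locales
      (simp_all add: prod_eq_iff s.scale_right_distrib t.scale_right_distrib s.scale_left_distrib
        t.scale_left_distrib s.scale_mult_left t.scale_mult_left s.scale_mult_right t.scale_mult_right)
qed

section \<open>Recognizable elements\<close>

locale algebra_with_variables = unital_algebra scale
  for scale :: "'k::comm_ring_1 \<Rightarrow> 'r::{ring,monoid_mult} \<Rightarrow> 'r" +
  fixes \<xi> :: "'n::finite \<Rightarrow> 'r"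
begin

definition extension :: "'r set \<Rightarrow> 'r set" where
  "extension X = {scale c 1 + (\<Sum>i\<in>UNIV. \<xi> i * h i) | c h. \<forall>i. h i \<in> span X}"

text \<open>A linear system without coordinates: the finite set \<open>Y\<close> is its own solution
  vector. For power series with \<open>\<xi>\<^sub>i = x\<^sub>i\<close> these are the recognizable
  series of automata theory.\<close>

definition recognizable :: "'r set" where
  "recognizable = {r. \<exists>Y. finite Y \<and> Y \<subseteq> extension Y \<and> r \<in> span Y}"

lemma extension_mono: "X \<subseteq> Y \<Longrightarrow> extension X \<subseteq> extension Y"
  using span_mono unfolding extension_def by blast

lemma extensionI: "(\<And>i. h i \<in> span X) \<Longrightarrow> scale c 1 + (\<Sum>i\<in>UNIV. \<xi> i * h i) \<in> extension X"
  by (auto simp: extension_def)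

lemma extension_add: "x \<in> extension X \<Longrightarrow> y \<in> extension X \<Longrightarrow> x + y \<in> extension X"
proof -
  assume "x \<in> extension X" "y \<in> extension X"
  then obtain c h d k where "x = scale c 1 + (\<Sum>i\<in>UNIV. \<xi> i * h i)" "y = scale d 1 + (\<Sum>i\<in>UNIV. \<xi> i * k i)"
    and "\<And>i. h i \<in> span X" "\<And>i. k i \<in> span X"
    by (auto simp: extension_def)
  then show ?thesis
    using extensionI[of "\<lambda>i. h i + k i" X "c + d"]
    by (simp add: span_add scale_left_distrib distrib_left sum.distrib add_ac)
qed

lemma extension_scale: "x \<in> extension X \<Longrightarrow> scale a x \<in> extension X"
proof -
  assume "x \<in> extension X"
  then obtain c h where "x = scale c 1 + (\<Sum>i\<in>UNIV. \<xi> i * h i)" "\<And>i. h i \<in> span X"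
    by (auto simp: extension_def)
  then show ?thesis
    using extensionI[of "\<lambda>i. scale a (h i)" X "a * c"]
    by (simp add: span_scale scale_right_distrib scale_sum_right scale_mult_right)
qed

lemma subspace_extension: "subspace (extension X)"
proof (rule subspaceI)
  show "0 \<in> extension X" using extensionI[of "\<lambda>_. 0" X 0] by (simp add: span_zero)
qed (auto intro: extension_add extension_scale)

lemma span_subset_extension: "Y \<subseteq> extension Y \<Longrightarrow> span Y \<subseteq> extension Y"
  by (rule span_minimal[OF _ subspace_extension])

lemma recognizable_one: "1 \<in> recognizable"
proof -
  have "1 \<in> extension {1}" using extensionI[of "\<lambda>_. 0" "{1}" 1] by (simp add: span_zero)
  then show ?thesis unfolding recognizable_def by (auto intro!: exI[of _ "{1}"] span_base)
qed

lemma recognizable_var: "\<xi> i \<in> recognizable"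
proof -
  have "1 \<in> extension {\<xi> i, 1}"
    using extensionI[of "\<lambda>_. 0" "{\<xi> i, 1}" 1] by (simp add: span_zero)
  moreover have "(\<Sum>j\<in>UNIV. \<xi> j * (if j = i then 1 else 0)) = \<xi> i"
    by (simp add: if_distrib cong: if_cong)
  then have "\<xi> i \<in> extension {\<xi> i, 1}"
    using extensionI[of "\<lambda>j. if j = i then 1 else 0" "{\<xi> i, 1}" 0]
    by (simp add: span_zero span_base)
  ultimately show ?thesis
    unfolding recognizable_def by (auto intro!: exI[of _ "{\<xi> i, 1}"] span_base)
qed

lemma recognizable_scale: "r \<in> recognizable \<Longrightarrow> scale c r \<in> recognizable"
  unfolding recognizable_def using span_scale by blast

lemma recognizable_add:
  assumes "r \<in> recognizable" "t \<in> recognizable"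
  shows "r + t \<in> recognizable"
proof -
  obtain X Y where X: "finite X" "X \<subseteq> extension X" "r \<in> span X"
    and Y: "finite Y" "Y \<subseteq> extension Y" "t \<in> span Y"
    using assms by (auto simp: recognizable_def)
  have "X \<union> Y \<subseteq> extension (X \<union> Y)"
    using X(2) Y(2) extension_mono[of X "X \<union> Y"] extension_mono[of Y "X \<union> Y"] by blast
  moreover have "r + t \<in> span (X \<union> Y)"
    using X(3) Y(3) span_mono[of X "X \<union> Y"] span_mono[of Y "X \<union> Y"] by (intro span_add) auto
  ultimately show ?thesis using X(1) Y(1) unfolding recognizable_def by blast
qed

lemma recognizable_zero: "0 \<in> recognizable"
  using recognizable_scale[OF recognizable_one, of 0] by simp

lemma recognizable_sum: "(\<And>a. a \<in> A \<Longrightarrow> f a \<in> recognizable) \<Longrightarrow> sum f A \<in> recognizable"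
  by (induction A rule: infinite_finite_induct) (auto intro: recognizable_add recognizable_zero)

text \<open>Multiplying a system \<open>X\<close> for \<open>r\<close> by \<open>t\<close> on the
  right turns each constant term into a multiple of \<open>t\<close>, which a system
  \<open>Y\<close> for \<open>t\<close> expresses. So the products \<open>x * t\<close> together
  with \<open>Y\<close> form a system.\<close>

lemma recognizable_mult:
  assumes "r \<in> recognizable" "t \<in> recognizable"
  shows "r * t \<in> recognizable"
proof -
  obtain X Y where X: "finite X" "X \<subseteq> extension X" "r \<in> span X"
    and Y: "finite Y" "Y \<subseteq> extension Y" "t \<in> span Y"
    using assms by (auto simp: recognizable_def)
  let ?Z = "(\<lambda>x. x * t) ` X \<union> Y"
  have span: "h * t \<in> span ?Z" if "h \<in> span X" for h
    using that
  proof (induction rule: span_induct)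
    case base
    show ?case
      by (intro subspaceI) (auto simp: distrib_right scale_mult_left span_zero span_add span_scale)
  next
    case (step x)
    then show ?case by (auto intro: span_base)
  qed
  have YZ: "extension Y \<subseteq> extension ?Z" by (rule extension_mono) auto
  have "x * t \<in> extension ?Z" if xX: "x \<in> X" for x
  proof -
    obtain c h where x: "x = scale c 1 + (\<Sum>i\<in>UNIV. \<xi> i * h i)" "\<And>i. h i \<in> span X"
      using subsetD[OF X(2) xX] unfolding extension_def by blast
    have "scale c t \<in> extension ?Z"
      using span_subset_extension[OF Y(2)] Y(3) YZ by (intro extension_scale) auto
    moreover have "scale 0 1 + (\<Sum>i\<in>UNIV. \<xi> i * (h i * t)) \<in> extension ?Z"
      using x(2) by (intro extensionI span)
    ultimately have "scale c t + (scale 0 1 + (\<Sum>i\<in>UNIV. \<xi> i * (h i * t))) \<in> extension ?Z"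
      by (rule extension_add)
    then show ?thesis
      by (simp add: x(1) distrib_right scale_mult_left sum_distrib_right mult.assoc)
  qed
  then have "?Z \<subseteq> extension ?Z" using Y(2) YZ by auto
  moreover have "finite ?Z" using X(1) Y(1) by simp
  ultimately show ?thesis
    unfolding recognizable_def by (intro CollectI exI[of _ ?Z] conjI span[OF X(3)])
qed

text \<open>The indexed form allows \<open>y\<close> to take the same value twice, as can happen for
  systems built from another one.\<close>

lemma recognizable_family:
  assumes "finite I" "\<And>a. a \<in> I \<Longrightarrow> y a = scale (v a) 1 + (\<Sum>i\<in>UNIV. \<xi> i * (\<Sum>b\<in>I. scale (Q i a b) (y b)))"
  shows "(\<Sum>a\<in>I. scale (u a) (y a)) \<in> recognizable"
proof -
  have span: "(\<Sum>b\<in>I. scale (c b) (y b)) \<in> span (y ` I)" for c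
    by (intro span_sum span_scale span_base) auto
  have "y ` I \<subseteq> extension (y ` I)"
  proof
    fix x assume "x \<in> y ` I"
    then obtain a where "x = y a" "a \<in> I" by blast
    then show "x \<in> extension (y ` I)"
      using assms(2)[of a] extensionI[of "\<lambda>i. \<Sum>b\<in>I. scale (Q i a b) (y b)" "y ` I" "v a"] span by simp
  qed
  then show ?thesis using assms(1) span unfolding recognizable_def by blast
qed

lemma recognizableE:
  assumes "r \<in> recognizable"
  obtains Y v Q u where "finite Y"
    "\<And>a. a \<in> Y \<Longrightarrow> a = scale (v a) 1 + (\<Sum>i\<in>UNIV. \<xi> i * (\<Sum>b\<in>Y. scale (Q i a b) b))"
    "r = (\<Sum>a\<in>Y. scale (u a) a)"
proof -
  obtain Y where Y: "finite Y" "Y \<subseteq> extension Y" "r \<in> span Y"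
    using assms by (auto simp: recognizable_def)
  have span: "\<exists>c. h = (\<Sum>b\<in>Y. scale (c b) b)" if "h \<in> span Y" for h
    using that span_finite[OF Y(1)] by auto
  have "\<exists>c q. a = scale c 1 + (\<Sum>i\<in>UNIV. \<xi> i * (\<Sum>b\<in>Y. scale (q i b) b))" if a: "a \<in> Y" for a
  proof -
    obtain c h where h: "a = scale c 1 + (\<Sum>i\<in>UNIV. \<xi> i * h i)" "\<forall>i. h i \<in> span Y"
      using subsetD[OF Y(2) a] unfolding extension_def by blast
    have "\<forall>i. \<exists>q. h i = (\<Sum>b\<in>Y. scale (q b) b)" using h(2) span by blast
    from choice[OF this] obtain q where "\<forall>i. h i = (\<Sum>b\<in>Y. scale (q i b) b)" by blast
    with h(1) show ?thesis by (intro exI[of _ c] exI[of _ q]) simp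
  qed
  then have "\<forall>a. \<exists>c q. a \<in> Y \<longrightarrow> a = scale c 1 + (\<Sum>i\<in>UNIV. \<xi> i * (\<Sum>b\<in>Y. scale (q i b) b))"
    by blast
  from choice[OF this] obtain v
    where "\<forall>a. \<exists>q. a \<in> Y \<longrightarrow> a = scale (v a) 1 + (\<Sum>i\<in>UNIV. \<xi> i * (\<Sum>b\<in>Y. scale (q i b) b))"
    by blast
  from choice[OF this] obtain q
    where q: "\<And>a. a \<in> Y \<Longrightarrow> a = scale (v a) 1 + (\<Sum>i\<in>UNIV. \<xi> i * (\<Sum>b\<in>Y. scale (q a i b) b))"
    by blast
  obtain u where "r = (\<Sum>b\<in>Y. scale (u b) b)" using span[OF Y(3)] by blast
  from that[OF Y(1) q this] show ?thesis .
qed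

end

section \<open>Left shifts of power series\<close>

definition left_shift :: "'n \<Rightarrow> ('k::comm_ring_1, 'n) ncfps \<Rightarrow> ('k, 'n) ncfps" where
  "left_shift i r = Abs_ncfps (\<lambda>w. nc_coeff r (i # w))"

lemma nc_coeff_left_shift [simp]: "nc_coeff (left_shift i r) w = nc_coeff r (i # w)"
  by (simp add: left_shift_def Abs_ncfps_inverse)

text \<open>A series amounts to its constant term and its left shifts. Thus a linear system over the
  power series is the same as a recursion for the coefficients along words.\<close>

lemma left_shift_decompose:
  fixes y :: "('k::comm_ring_1, 'n::finite) ncfps"
  shows "y = nc_scale c 1 + (\<Sum>i\<in>UNIV. nc_var i * h i) \<longleftrightarrow>
    nc_coeff y [] = c \<and> (\<forall>i. left_shift i y = h i)"
proof -
  let ?z = "nc_scale c 1 + (\<Sum>i\<in>UNIV. nc_var i * h i)"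
  have z: "nc_coeff ?z [] = c" "\<forall>i. left_shift i ?z = h i"
    by (auto intro!: ncfps_eqI)
  show ?thesis
  proof
    assume "y = ?z"
    with z show "nc_coeff y [] = c \<and> (\<forall>i. left_shift i y = h i)" by (simp only:) simp
  next
    assume y: "nc_coeff y [] = c \<and> (\<forall>i. left_shift i y = h i)"
    show "y = ?z"
    proof (rule ncfps_eqI)
      fix w show "nc_coeff y w = nc_coeff ?z w"
      proof (cases w)
        case (Cons i w')
        have "left_shift i y = left_shift i ?z" using y z(2) by metis
        from arg_cong[OF this, of "\<lambda>r. nc_coeff r w'"] Cons show ?thesis
          by (simp only: nc_coeff_left_shift)
      qed (use y z(1) in metis)
    qed
  qed
qed

lemma left_shift_simps:
  "left_shift i (f + g) = left_shift i f + left_shift i g"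
  "left_shift i (nc_scale c f) = nc_scale c (left_shift i f)" "left_shift i 1 = 0"
  "left_shift i (sum F A) = (\<Sum>a\<in>A. left_shift i (F a))"
  by (rule ncfps_eqI; simp)+

lemma left_shift_times:
  fixes f g :: "('k::comm_ring_1, 'n::finite) ncfps"
  shows "left_shift i (f * g) = left_shift i f * g + nc_scale (nc_coeff f []) (left_shift i g)"
proof -
  interpret unital_algebra "nc_scale :: 'k \<Rightarrow> ('k, 'n) ncfps \<Rightarrow> _" by (rule unital_algebra_nc_scale)
  have "f = nc_scale (nc_coeff f []) 1 + (\<Sum>i\<in>UNIV. nc_var i * left_shift i f)"
    by (rule iffD2[OF left_shift_decompose]) simp
  then have "f * g = (nc_scale (nc_coeff f []) 1 + (\<Sum>i\<in>UNIV. nc_var i * left_shift i f)) * g"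
    by (rule arg_cong[of _ _ "\<lambda>x. x * g"])
  also have "\<dots> = nc_scale (nc_coeff f []) g + (\<Sum>i\<in>UNIV. nc_var i * (left_shift i f * g))"
    by (simp add: distrib_right scale_mult_left sum_distrib_right mult.assoc)
  finally have *: "f * g = \<dots>" .
  have "left_shift i (\<Sum>j\<in>UNIV. nc_var j * (left_shift j f * g)) = left_shift i f * g"
    by (rule ncfps_eqI) simp
  then show ?thesis unfolding * by (simp add: left_shift_simps add.commute)
qed

section \<open>The universal property\<close>

locale inverting_hom =
  fixes s :: "'k::comm_ring_1 \<Rightarrow> 's::{ring,monoid_mult} \<Rightarrow> 's"
    and f :: "('k, 'n::finite) free_algebra \<Rightarrow> 's"
  assumes hom: "algebra_hom pm_scale s f"
    and inv: "inverting (one_plus_matrices fa_aug) f"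
begin

lemmas fD = algebra_homD[OF hom]

sublocale S: unital_algebra s by (rule fD(2))
sublocale N: unital_algebra "nc_scale :: 'k \<Rightarrow> ('k, 'n) ncfps \<Rightarrow> _" by (rule unital_algebra_nc_scale)
sublocale P: algebra_with_variables "pair_scale nc_scale s" "\<lambda>i :: 'n. (nc_var i, f (fa_var i))"
  unfolding algebra_with_variables_def
  by (rule unital_algebra_pair_scale[OF N.unital_algebra_axioms S.unital_algebra_axioms])

text \<open>Splits a system in the product algebra into coordinates: a recursion of shifts for the
  series and a linear system in \<open>S\<close> with the same \<open>v\<close> and
  \<open>Q\<close>.\<close>

lemma graphE:
  assumes "(r, t) \<in> P.recognizable"
  obtains Y v Q u where "finite Y"
    "\<And>a. a \<in> Y \<Longrightarrow> nc_coeff (fst a) [] = v a"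
    "\<And>a i. a \<in> Y \<Longrightarrow> left_shift i (fst a) = (\<Sum>b\<in>Y. nc_scale (Q i a b) (fst b))"
    "\<And>a. a \<in> Y \<Longrightarrow> snd a = s (v a) 1 + (\<Sum>i\<in>UNIV. f (fa_var i) * (\<Sum>b\<in>Y. s (Q i a b) (snd b)))"
    "r = (\<Sum>a\<in>Y. nc_scale (u a) (fst a))" "t = (\<Sum>a\<in>Y. s (u a) (snd a))"
proof -
  obtain Y u v Q where Y: "finite Y"
    "\<And>a. a \<in> Y \<Longrightarrow> a = pair_scale nc_scale s (v a) 1 +
       (\<Sum>i\<in>UNIV. (nc_var i, f (fa_var i)) * (\<Sum>b\<in>Y. pair_scale nc_scale s (Q i a b) b))"
    "(r, t) = (\<Sum>a\<in>Y. pair_scale nc_scale s (u a) a)"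
    by (rule P.recognizableE[OF assms]) (rule that)
  have fst: "fst a = nc_scale (v a) 1 + (\<Sum>i\<in>UNIV. nc_var i * (\<Sum>b\<in>Y. nc_scale (Q i a b) (fst b)))"
    if "a \<in> Y" for a
    using arg_cong[OF Y(2)[OF that], of fst] by (simp add: fst_sum)
  have snd: "snd a = s (v a) 1 + (\<Sum>i\<in>UNIV. f (fa_var i) * (\<Sum>b\<in>Y. s (Q i a b) (snd b)))"
    if "a \<in> Y" for a
    using arg_cong[OF Y(2)[OF that], of snd] by (simp add: snd_sum)
  show ?thesis
  proof (rule that[OF Y(1) _ _ snd])
    show "nc_coeff (fst a) [] = v a" if "a \<in> Y" for a
      using iffD1[OF left_shift_decompose fst[OF that]] by simp
    show "left_shift i (fst a) = (\<Sum>b\<in>Y. nc_scale (Q i a b) (fst b))" if "a \<in> Y" for a i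
      using iffD1[OF left_shift_decompose fst[OF that]] by simp
    show "r = (\<Sum>a\<in>Y. nc_scale (u a) (fst a))"
      using arg_cong[OF Y(3), of fst] by (simp add: fst_sum)
    show "t = (\<Sum>a\<in>Y. s (u a) (snd a))"
      using arg_cong[OF Y(3), of snd] by (simp add: snd_sum)
  qed
qed

text \<open>With \<open>R = 1 / (1 - r)\<close>, the products of \<open>R\<close> with the elements of a system for \<open>r\<close> again form a
  system, since \<open>R = 1 + r * R\<close>.\<close>

lemma graph_quasi_inverse:
  assumes "(r, t) \<in> P.recognizable" "nc_coeff r [] = 0"
  shows "\<exists>t'. (quasi_inverse r, t') \<in> P.recognizable"
proof -
  obtain Y u v Q where Y: "finite Y"
    and const: "\<And>a. a \<in> Y \<Longrightarrow> nc_coeff (fst a) [] = v a"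
    and shift: "\<And>a i. a \<in> Y \<Longrightarrow> left_shift i (fst a) = (\<Sum>b\<in>Y. nc_scale (Q i a b) (fst b))"
    and "\<And>a. a \<in> Y \<Longrightarrow> snd a = s (v a) 1 + (\<Sum>i\<in>UNIV. f (fa_var i) * (\<Sum>b\<in>Y. s (Q i a b) (snd b)))"
    and r: "r = (\<Sum>a\<in>Y. nc_scale (u a) (fst a))" and "t = (\<Sum>a\<in>Y. s (u a) (snd a))"
    by (rule graphE[OF assms(1)]) (rule that)
  define R where "R = 1 + quasi_inverse r"
  have rR: "r * R = quasi_inverse r"
    using quasi_inverse_unfold[OF assms(2)] by (simp add: R_def distrib_left)
  have R_Nil: "nc_coeff R [] = 1" by (simp add: R_def)
  have R: "R = 1 + r * R" unfolding rR by (simp add: R_def)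
  \<comment> \<open>Shifting \<open>y\<^sub>a R\<close> gives the shift of \<open>y\<^sub>a\<close>
    times \<open>R\<close>, plus \<open>v a\<close> times the shift of \<open>R\<close>. The latter
    is the shift of \<open>r = \<Sum>c\<in>Y. u c * y\<^sub>c\<close> times \<open>R\<close>, as
    \<open>r\<close> has no constant term; this accounts for the second summand.\<close>
  define Q' where "Q' i a b = Q i a b + v a * (\<Sum>c\<in>Y. u c * Q i c b)" for i a b
  \<comment> \<open>The second coordinates are obtained by solving the new system in
    \<open>S\<close>, instead of inverting \<open>1 - t\<close> there.\<close>
  obtain z where z: "\<forall>a\<in>Y. z a = s (v a) 1 + (\<Sum>i\<in>UNIV. f (fa_var i) * (\<Sum>b\<in>Y. s (Q' i a b) (z b)))"
    using inverting_linear_system(1)[OF hom inv Y, of "\<lambda>a. s (v a) 1" Q'] by blast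
  have shift_r: "left_shift i r = (\<Sum>b\<in>Y. nc_scale (\<Sum>c\<in>Y. u c * Q i c b) (fst b))" for i
  proof -
    have "left_shift i r = (\<Sum>c\<in>Y. \<Sum>b\<in>Y. nc_scale (u c * Q i c b) (fst b))"
      unfolding r left_shift_simps by (intro sum.cong refl) (simp add: shift N.scale_sum_right)
    also have "\<dots> = (\<Sum>b\<in>Y. nc_scale (\<Sum>c\<in>Y. u c * Q i c b) (fst b))"
      by (subst sum.swap) (simp add: N.scale_sum_left)
    finally show ?thesis .
  qed
  have shift_R: "left_shift i R = left_shift i r * R" for i
    by (subst R) (simp add: left_shift_simps left_shift_times assms(2))
  have shift': "left_shift i (fst a * R) = (\<Sum>b\<in>Y. nc_scale (Q' i a b) (fst b * R))" if "a \<in> Y" for a i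
  proof -
    have "left_shift i (fst a * R) =
        (\<Sum>b\<in>Y. nc_scale (Q i a b) (fst b)) * R +
        nc_scale (v a) ((\<Sum>b\<in>Y. nc_scale (\<Sum>c\<in>Y. u c * Q i c b) (fst b)) * R)"
      using that by (simp add: left_shift_times shift const shift_R flip: shift_r)
    also have "\<dots> = (\<Sum>b\<in>Y. nc_scale (Q' i a b) (fst b * R))"
      by (simp add: Q'_def sum_distrib_right N.scale_mult_left N.scale_sum_right N.scale_left_distrib
          sum.distrib)
    finally show ?thesis .
  qed
  let ?y = "\<lambda>a. (fst a * R, z a)"
  define p where "p = (\<Sum>a\<in>Y. pair_scale nc_scale s (u a) (?y a))"
  have "p \<in> P.recognizable"
    unfolding p_def
  proof (rule P.recognizable_family[OF Y])
    fix a assume a: "a \<in> Y"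
    have "fst a * R = nc_scale (v a) 1 + (\<Sum>i\<in>UNIV. nc_var i * (\<Sum>b\<in>Y. nc_scale (Q' i a b) (fst b * R)))"
      using a by (intro iffD2[OF left_shift_decompose]) (simp add: shift' const R_Nil)
    with z a show "?y a = pair_scale nc_scale s (v a) 1 + (\<Sum>i\<in>UNIV. (nc_var i, f (fa_var i)) *
        (\<Sum>b\<in>Y. pair_scale nc_scale s (Q' i a b) (?y b)))"
      by (simp add: prod_eq_iff fst_sum snd_sum)
  qed
  moreover have "fst p = quasi_inverse r"
    unfolding rR[symmetric] p_def by (simp add: fst_sum r sum_distrib_right N.scale_mult_left)
  ultimately show ?thesis by (metis prod.collapse)
qed

text \<open>The coefficient vectors of the series of a system lie in a free module over a finitely generated,
  hence noetherian, subring of \<open>'k\<close>. So finitely many of them span the others, with coefficients that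
  define a system over \<open>W\<close> whose solution \<open>\<zeta>\<close> maps to that of the given system.\<close>

lemma graph_zero:
  assumes "(0, t) \<in> P.recognizable"
  shows "t = 0"
proof -
  obtain Y u v Q where Y: "finite Y"
    and const: "\<And>a. a \<in> Y \<Longrightarrow> nc_coeff (fst a) [] = v a"
    and shift: "\<And>a i. a \<in> Y \<Longrightarrow> left_shift i (fst a) = (\<Sum>b\<in>Y. nc_scale (Q i a b) (fst b))"
    and snd: "\<And>a. a \<in> Y \<Longrightarrow> snd a = s (v a) 1 + (\<Sum>i\<in>UNIV. f (fa_var i) * (\<Sum>b\<in>Y. s (Q i a b) (snd b)))"
    and zero: "0 = (\<Sum>a\<in>Y. nc_scale (u a) (fst a))" and t: "t = (\<Sum>a\<in>Y. s (u a) (snd a))"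
    by (rule graphE[OF assms]) (rule that)
  \<comment> \<open>\<open>F w\<close> is the vector of coefficients at \<open>w\<close>. It starts
    at \<open>v\<close> and is multiplied by \<open>Q i\<close> for each letter, so its entries stay
    in any subring that contains those of \<open>v\<close> and \<open>Q\<close>.\<close>
  define F where "F w a = nc_coeff (fst a) w" for w and a :: "('k, 'n) ncfps \<times> 's"
  have F_Nil: "F [] a = v a" if "a \<in> Y" for a
    using const[OF that] by (simp add: F_def)
  have F_Cons: "F (i # w) a = (\<Sum>b\<in>Y. Q i a b * F w b)" if "a \<in> Y" for a i w
    using arg_cong[OF shift[OF that, of i], of "\<lambda>y. nc_coeff y w"] by (simp add: F_def)
  let ?E = "v ` Y \<union> (\<lambda>(i, a, b). Q i a b) ` (UNIV \<times> Y \<times> Y)"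
  have "\<forall>w. \<forall>a\<in>Y. F w a \<in> B" if B: "is_subring B" "?E \<subseteq> B" for B
  proof
    fix w show "\<forall>a\<in>Y. F w a \<in> B"
    proof (induction w)
      case Nil
      then show ?case using B(2) by (auto simp: F_Nil)
    next
      case (Cons i w)
      have "Q i a b \<in> B" if "a \<in> Y" "b \<in> Y" for a b
        using B(2) that by (auto simp: image_subset_iff)
      with Cons show ?case
        by (auto simp: F_Cons intro!: is_subring_sum[OF B(1)] is_subring_closed(6)[OF B(1)])
    qed
  qed
  note generated = this
  have "finite ?E" using Y by simp
  then have "\<exists>W. finite W \<and> (\<forall>w. \<exists>c. \<forall>a\<in>Y. F w a = (\<Sum>w'\<in>W. c w' * F w' a))"
    by (rule finite_generating_subfamily[OF _ Y]) (rule generated)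
  then obtain W where W: "finite W" "\<forall>w. \<exists>c. \<forall>a\<in>Y. F w a = (\<Sum>w'\<in>W. c w' * F w' a)"
    by (elim exE conjE)
  from choice[OF W(2)] obtain c where c: "\<And>w a. a \<in> Y \<Longrightarrow> F w a = (\<Sum>w'\<in>W. c w w' * F w' a)"
    by blast
  \<comment> \<open>On the free module on \<open>W\<close>, which maps to the vectors by
    \<open>w \<mapsto> F w\<close>, the coefficients \<open>c []\<close> lift
    \<open>v = F []\<close>, and \<open>c (i # w)\<close> lifts \<open>F (i # w)\<close>, the image
    of \<open>F w\<close> under \<open>Q i\<close>.\<close>
  obtain \<zeta> where \<zeta>: "\<forall>w'\<in>W. \<zeta> w' = s (c [] w') 1 +
      (\<Sum>i\<in>UNIV. f (fa_var i) * (\<Sum>w\<in>W. s (c (i # w) w') (\<zeta> w)))"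
    using inverting_linear_system(1)[OF hom inv W(1), of "\<lambda>w'. s (c [] w') 1" "\<lambda>i w' w. c (i # w) w'"]
    by blast
  define y where "y a = (\<Sum>w\<in>W. s (F w a) (\<zeta> w))" for a
  have y: "y a = s (v a) 1 + (\<Sum>i\<in>UNIV. f (fa_var i) * (\<Sum>b\<in>Y. s (Q i a b) (y b)))" if a: "a \<in> Y" for a
  proof -
    have "y a = (\<Sum>w'\<in>W. s (c [] w' * F w' a) 1 +
        (\<Sum>i\<in>UNIV. f (fa_var i) * (\<Sum>w\<in>W. s (c (i # w) w' * F w' a) (\<zeta> w))))"
      unfolding y_def
    proof (intro sum.cong refl)
      fix w' assume "w' \<in> W"
      then have "s (F w' a) (\<zeta> w') = s (F w' a) (s (c [] w') 1 +
          (\<Sum>i\<in>UNIV. f (fa_var i) * (\<Sum>w\<in>W. s (c (i # w) w') (\<zeta> w))))"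
        using \<zeta> by (intro arg_cong[of _ _ "s (F w' a)"]) blast
      then show "s (F w' a) (\<zeta> w') = s (c [] w' * F w' a) 1 +
          (\<Sum>i\<in>UNIV. f (fa_var i) * (\<Sum>w\<in>W. s (c (i # w) w' * F w' a) (\<zeta> w)))"
        by (simp add: S.scale_right_distrib S.scale_sum_right mult.commute flip: S.scale_mult_right)
    qed
    also have "\<dots> = s (F [] a) 1 + (\<Sum>i\<in>UNIV. f (fa_var i) * (\<Sum>w\<in>W. s (F (i # w) a) (\<zeta> w)))"
    proof -
      have "(\<Sum>w'\<in>W. \<Sum>i\<in>UNIV. f (fa_var i) * (\<Sum>w\<in>W. s (c (i # w) w' * F w' a) (\<zeta> w))) =
          (\<Sum>i\<in>UNIV. f (fa_var i) * (\<Sum>w\<in>W. \<Sum>w'\<in>W. s (c (i # w) w' * F w' a) (\<zeta> w)))"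
        by (subst sum.swap, subst sum.swap[of _ W W]) (simp add: sum_distrib_left)
      then show ?thesis
        by (simp add: sum.distrib c[OF a, of "[]"] c[OF a, of "_ # _"] S.scale_sum_left)
    qed
    also have "\<dots> = s (v a) 1 + (\<Sum>i\<in>UNIV. f (fa_var i) * (\<Sum>b\<in>Y. s (Q i a b) (y b)))"
    proof -
      have "(\<Sum>w\<in>W. s (F (i # w) a) (\<zeta> w)) = (\<Sum>b\<in>Y. s (Q i a b) (y b))" for i
        unfolding y_def F_Cons[OF a] S.scale_sum_left S.scale_sum_right S.scale_scale
        by (rule sum.swap)
      then show ?thesis by (simp add: F_Nil[OF a])
    qed
    finally show ?thesis .
  qed
  \<comment> \<open>The pushed-down solution \<open>y\<close> and the given second coordinates solve
    the same system, so their difference solves the homogeneous one and vanishes.\<close>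
  have "snd a = y a" if "a \<in> Y" for a
  proof -
    have "snd a - y a = 0"
    proof (rule inverting_linear_system(2)[OF hom inv Y _ that, of "\<lambda>a. snd a - y a" Q])
      fix a assume "a \<in> Y"
      then have "snd a - y a = (s (v a) 1 + (\<Sum>i\<in>UNIV. f (fa_var i) * (\<Sum>b\<in>Y. s (Q i a b) (snd b)))) -
          (s (v a) 1 + (\<Sum>i\<in>UNIV. f (fa_var i) * (\<Sum>b\<in>Y. s (Q i a b) (y b))))"
        using snd y by (intro arg_cong2[of _ _ _ _ "(-)"]) blast+
      then show "snd a - y a = (\<Sum>i\<in>UNIV. f (fa_var i) * (\<Sum>b\<in>Y. s (Q i a b) (snd b - y b)))"
        by (simp add: S.scale_right_diff_distrib sum_subtractf right_diff_distrib)
    qed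
    then show ?thesis by simp
  qed
  then have "t = (\<Sum>a\<in>Y. s (u a) (y a))" unfolding t by (intro sum.cong) auto
  also have "\<dots> = (\<Sum>w\<in>W. s (\<Sum>a\<in>Y. u a * F w a) (\<zeta> w))"
    unfolding y_def S.scale_sum_left S.scale_sum_right S.scale_scale by (rule sum.swap)
  also have "\<dots> = 0"
  proof -
    \<comment> \<open>This is the coefficient at \<open>w\<close> of the given combination of
      series, which is zero.\<close>
    have "(\<Sum>a\<in>Y. u a * F w a) = 0" for w
      using arg_cong[OF zero, of "\<lambda>y. nc_coeff y w"] by (simp add: F_def)
    then show ?thesis by simp
  qed
  finally show ?thesis .
qed

lemma graph_unique:
  assumes "(r, t) \<in> P.recognizable" "(r, t') \<in> P.recognizable"
  shows "t = t'"
proof -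
  have "(r, t) + pair_scale nc_scale s (-1) (r, t') \<in> P.recognizable"
    by (intro P.recognizable_add P.recognizable_scale assms)
  also have "(r, t) + pair_scale nc_scale s (-1) (r, t') = (0, t - t')"
    by (simp add: prod_eq_iff)
  finally show ?thesis using graph_zero by fastforce
qed

lemma graph_fa: "(fa_to_nc p, f p) \<in> P.recognizable"
proof -
  let ?h = "\<lambda>p. (fa_to_nc p, f p)"
  note nD = algebra_homD[OF algebra_hom_fa_to_nc]
  have word: "?h (Poly_Mapping.single (Word w) 1) \<in> P.recognizable" for w
  proof (induction w)
    case Nil
    have "Poly_Mapping.single (Word []) 1 = (1 :: ('k, 'n) free_algebra)"
      by (simp flip: zero_free_monoid_def)
    then show ?case
      using P.recognizable_one by (simp add: nD(6) fD(6) one_prod_def)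
  next
    case (Cons i w)
    have "?h (Poly_Mapping.single (Word (i # w)) 1) =
        (nc_var i, f (fa_var i)) * ?h (Poly_Mapping.single (Word w) 1)"
      unfolding single_Word_Cons by (simp add: prod_eq_iff nD(5) fD(5))
    with P.recognizable_mult[OF P.recognizable_var Cons] show ?case by simp
  qed
  have "?h (Poly_Mapping.single m a) \<in> P.recognizable" for m a
  proof -
    obtain w where m: "m = Word w" by (cases m)
    have "?h (pm_scale a (Poly_Mapping.single (Word w) 1)) =
        pair_scale nc_scale s a (?h (Poly_Mapping.single (Word w) 1))"
      by (simp add: prod_eq_iff nD(4) fD(4))
    then show ?thesis
      using P.recognizable_scale[OF word[of w], of a] by (simp add: m pm_scale_single)
  qed
  then have "(\<Sum>m\<in>Poly_Mapping.keys p. ?h (Poly_Mapping.single m (Poly_Mapping.lookup p m))) \<in> P.recognizable"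
    by (intro P.recognizable_sum)
  also have "(\<Sum>m\<in>Poly_Mapping.keys p. ?h (Poly_Mapping.single m (Poly_Mapping.lookup p m))) =
      ?h (\<Sum>m\<in>Poly_Mapping.keys p. Poly_Mapping.single m (Poly_Mapping.lookup p m))"
    by (simp add: prod_eq_iff fst_sum snd_sum nD(10) fD(10))
  finally show ?thesis by (simp flip: poly_mapping_eq_sum_single)
qed

lemma graph_total: "r \<in> rational_closure \<Longrightarrow> \<exists>t. (r, t) \<in> P.recognizable"
proof -
  let ?D = "{r. \<exists>t. (r, t) \<in> P.recognizable}"
  have "rational_closure \<subseteq> ?D"
  proof (rule rational_closure_subset)
    show "unital_subalgebra nc_scale ?D"
      unfolding unital_subalgebra_def
    proof (intro conjI ballI allI; (elim CollectE exE)?; intro CollectI)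
      show "\<exists>t. (1, t) \<in> P.recognizable"
        using P.recognizable_one by (auto simp: one_prod_def)
      fix x y t t' assume x: "(x, t) \<in> P.recognizable"
      show "\<exists>t. (nc_scale a x, t) \<in> P.recognizable" for a
        using P.recognizable_scale[OF x, of a] by (auto simp: pair_scale_def)
      assume y: "(y, t') \<in> P.recognizable"
      show "\<exists>t. (x + y, t) \<in> P.recognizable"
        using P.recognizable_add[OF x y] by (auto simp: plus_prod_def)
      show "\<exists>t. (x * y, t) \<in> P.recognizable"
        using P.recognizable_mult[OF x y] by (auto simp: times_prod_def)
    qed
    show "range fa_to_nc \<subseteq> ?D" using graph_fa by auto
    show "quasi_inverse x \<in> ?D" if "x \<in> ?D" "nc_coeff x [] = 0" for x
      using that graph_quasi_inverse by blast
  qed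
  then show "r \<in> rational_closure \<Longrightarrow> \<exists>t. (r, t) \<in> P.recognizable" by blast
qed

text \<open>Because the graph is single-valued and closed under the operations, \<open>g\<close> is
  multiplicative and linear without any choice of systems.\<close>

lemma hom_extends: "\<exists>g. algebra_hom ncrat_scale s g \<and> f = g \<circ> fa_to_ncrat"
proof -
  define g where "g r = (THE t. (nc_of_rat r, t) \<in> P.recognizable)" for r
  have g: "(nc_of_rat r, g r) \<in> P.recognizable" for r
    unfolding g_def using graph_total[OF nc_of_rat] graph_unique by (metis (mono_tags, lifting) theI')
  have eq: "g r = t" if "(nc_of_rat r, t) \<in> P.recognizable" for r t
    using graph_unique[OF g that] .
  have "algebra_hom ncrat_scale s g"
  proof (rule algebra_homI[OF unital_algebra_ncrat_scale S.unital_algebra_axioms])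
    show "g (x + y) = g x + g y" for x y
      using P.recognizable_add[OF g[of x] g[of y]] by (intro eq) (simp add: plus_prod_def)
    show "g (ncrat_scale c x) = s c (g x)" for c x
      using P.recognizable_scale[OF g[of x], of c] by (intro eq) (simp add: pair_scale_def)
    show "g (x * y) = g x * g y" for x y
      using P.recognizable_mult[OF g[of x] g[of y]] by (intro eq) (simp add: times_prod_def)
    show "g 1 = 1"
      using P.recognizable_one by (intro eq) (simp add: one_prod_def)
  qed
  moreover have "f = g \<circ> fa_to_ncrat"
  proof
    fix p show "f p = (g \<circ> fa_to_ncrat) p"
      using eq[of "fa_to_ncrat p" "f p"] graph_fa[of p] by simp
  qed
  ultimately show ?thesis by blast
qed

end

lemma universal_localization_free_algebra:
  "universal_localization TYPE('s::{ring,monoid_mult}) pm_scale ncrat_scale (one_plus_matrices fa_aug)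
     (fa_to_ncrat :: ('k::comm_ring_1, 'n::finite) free_algebra \<Rightarrow> ('k, 'n) ncrat)"
  unfolding universal_localization_def
proof (intro conjI allI impI algebra_hom_fa_to_ncrat inverting_fa_to_ncrat)
  fix s :: "'k \<Rightarrow> 's \<Rightarrow> 's" and f :: "('k, 'n) free_algebra \<Rightarrow> 's"
  assume f: "algebra_hom pm_scale s f \<and> inverting (one_plus_matrices fa_aug) f"
  then interpret inverting_hom s f by (simp add: inverting_hom_def)
  show "\<exists>!g. algebra_hom ncrat_scale s g \<and> f = g \<circ> fa_to_ncrat"
  proof (rule ex_ex1I[OF hom_extends])
    fix g g' assume "algebra_hom ncrat_scale s g \<and> f = g \<circ> fa_to_ncrat"
      "algebra_hom ncrat_scale s g' \<and> f = g' \<circ> fa_to_ncrat"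
    then show "g = g'" by (intro ncrat_hom_eqI[of s g g']) (auto simp: fun_eq_iff)
  qed
qed

section \<open>Passage from the free algebra to the group algebra\<close>

definition fa_to_fga :: "('k::comm_ring_1, 'n) free_algebra \<Rightarrow> ('k, 'n) free_group_algebra" where
  "fa_to_fga p = (\<Sum>g\<in>Poly_Mapping.keys p.
     pm_scale (Poly_Mapping.lookup p g) (prod_list (map fga_var (letters g))))"

lemma algebra_hom_fa_to_fga: "algebra_hom pm_scale pm_scale fa_to_fga"
  unfolding fa_to_fga_def[abs_def]
  by (rule unital_algebra.algebra_hom_monoid_algebra[OF unital_algebra_pm_scale])
     (auto simp: zero_free_monoid_def plus_free_monoid_def)

lemma fa_to_fga_var: "fa_to_fga (fa_var i) = (fga_var i :: ('k::comm_ring_1, 'n) free_group_algebra)"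
proof -
  interpret unital_algebra "pm_scale :: 'k \<Rightarrow> ('k, 'n) free_group_algebra \<Rightarrow> _"
    by (rule unital_algebra_pm_scale)
  show ?thesis by (simp add: fa_to_fga_def fa_var_def)
qed

lemma fga_to_ncrat_fa_to_fga: "fga_to_ncrat \<circ> fa_to_fga = fa_to_ncrat"
  by (rule fa_hom_eqI[OF algebra_hom_comp[OF algebra_hom_fa_to_fga algebra_hom_fga_to_ncrat]
        algebra_hom_fa_to_ncrat])
     (auto intro: nc_of_rat_eqI simp: fa_to_fga_var)

text \<open>Sending \<open>x\<^sub>i\<close> to \<open>t\<^sub>i - 1\<close> carries one
  augmentation ideal into the other, hence matrices to be inverted to matrices to be
  inverted.\<close>

lemma inverting_fa_to_fga:
  assumes "inverting (one_plus_matrices fga_aug) f"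
  shows "inverting (one_plus_matrices fa_aug) (f \<circ> (fa_to_fga :: ('k::comm_ring_1, 'n::finite) free_algebra \<Rightarrow> _))"
  unfolding inverting_def
proof
  note hD = algebra_homD[OF algebra_hom_fa_to_fga]
  fix M :: "('k, 'n) free_algebra mat" assume "M \<in> one_plus_matrices fa_aug"
  then obtain l Q where M: "1 \<le> l" "M = 1\<^sub>m l + Q" "Q \<in> carrier_mat l l" "elements_mat Q \<subseteq> fa_aug"
    by (auto simp: one_plus_matrices_def)
  have "fa_to_fga p \<in> fga_aug" if "p \<in> fa_aug" for p :: "('k, 'n) free_algebra"
  proof -
    obtain a where "p = (\<Sum>i\<in>UNIV. a i * fa_var i)"
      using \<open>p \<in> fa_aug\<close> by (auto simp: fa_aug_def left_span_def)
    then have "fa_to_fga p = (\<Sum>i\<in>UNIV. fa_to_fga (a i) * fga_var i)"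
      by (simp add: hD(5,10) fa_to_fga_var)
    then show ?thesis
      unfolding fga_aug_def left_span_def by (intro CollectI exI[of _ "\<lambda>i. fa_to_fga (a i)"] conjI TrueI)
  qed
  then have "elements_mat (map_mat fa_to_fga Q) \<subseteq> fga_aug" using M(4) by auto
  moreover have "map_mat fa_to_fga M = 1\<^sub>m l + map_mat fa_to_fga Q"
    using M by (intro eq_matI) (auto simp: hD)
  ultimately have "map_mat fa_to_fga M \<in> one_plus_matrices fga_aug"
    unfolding one_plus_matrices_def using M
    by (intro CollectI exI[of _ l] exI[of _ "map_mat fa_to_fga Q"]) auto
  then have "invertible_matrix (map_mat f (map_mat fa_to_fga M))"
    using assms by (simp add: inverting_def)
  moreover have "map_mat f (map_mat fa_to_fga M) = map_mat (f \<circ> fa_to_fga) M"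
    by (intro eq_matI) auto
  ultimately show "invertible_matrix (map_mat (f \<circ> fa_to_fga) M)" by simp
qed

text \<open>The extension of the restricted map agrees with \<open>f\<close> on the
  \<open>x\<^sub>i\<close>, and these determine a homomorphism on the group algebra. Uniqueness
  holds because the values on the free algebra already fix a homomorphism on the rational
  closure.\<close>

lemma universal_localization_free_group_algebra:
  "universal_localization TYPE('s::{ring,monoid_mult}) pm_scale ncrat_scale (one_plus_matrices fga_aug)
     (fga_to_ncrat :: ('k::comm_ring_1, 'n::finite) free_group_algebra \<Rightarrow> ('k, 'n) ncrat)"
  unfolding universal_localization_def
proof (intro conjI allI impI algebra_hom_fga_to_ncrat inverting_fga_to_ncrat)
  fix s :: "'k \<Rightarrow> 's \<Rightarrow> 's" and f :: "('k, 'n) free_group_algebra \<Rightarrow> 's"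
  assume "algebra_hom pm_scale s f \<and> inverting (one_plus_matrices fga_aug) f"
  then have f: "algebra_hom pm_scale s f" and inv: "inverting (one_plus_matrices fga_aug) f" by auto
  interpret inverting_hom s "f \<circ> fa_to_fga"
    by (rule inverting_hom.intro[OF algebra_hom_comp[OF algebra_hom_fa_to_fga f] inverting_fa_to_fga[OF inv]])
  show "\<exists>!g. algebra_hom ncrat_scale s g \<and> f = g \<circ> fga_to_ncrat"
  proof (rule ex_ex1I)
    obtain g where g: "algebra_hom ncrat_scale s g" "f \<circ> fa_to_fga = g \<circ> fa_to_ncrat"
      using hom_extends by blast
    have "f = g \<circ> fga_to_ncrat"
    proof (rule fga_hom_eqI[OF f algebra_hom_comp[OF algebra_hom_fga_to_ncrat g(1)]])
      fix i
      show "f (fga_var i) = (g \<circ> fga_to_ncrat) (fga_var i)"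
        using fun_cong[OF g(2), of "fa_var i"]
        by (simp add: fa_to_fga_var flip: fga_to_ncrat_fa_to_fga)
    qed
    with g(1) show "\<exists>g. algebra_hom ncrat_scale s g \<and> f = g \<circ> fga_to_ncrat" by blast
  next
    fix g g' assume gg': "algebra_hom ncrat_scale s g \<and> f = g \<circ> fga_to_ncrat"
      "algebra_hom ncrat_scale s g' \<and> f = g' \<circ> fga_to_ncrat"
    have "g (fa_to_ncrat p) = g' (fa_to_ncrat p)" for p
      using gg' by (simp add: fun_eq_iff flip: fga_to_ncrat_fa_to_fga)
    with gg' show "g = g'" by (intro ncrat_hom_eqI[of s g g']) auto
  qed
qed

text \<open>The two injectivity claims express that the localization maps are inclusions of the free
  algebra and of the group algebra.\<close>

theorem theorem4p3:
  shows
    "universal_localization TYPE('s::{ring,monoid_mult}) pm_scale ncrat_scale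
       (one_plus_matrices fa_aug)
       (fa_to_ncrat :: ('k::idom, 'n::finite) free_algebra \<Rightarrow> ('k, 'n) ncrat) \<and>
     inj (fa_to_ncrat :: ('k, 'n) free_algebra \<Rightarrow> ('k, 'n) ncrat) \<and>
     universal_localization TYPE('s) pm_scale ncrat_scale
       (one_plus_matrices fga_aug)
       (fga_to_ncrat :: ('k, 'n) free_group_algebra \<Rightarrow> ('k, 'n) ncrat) \<and>
     inj (fga_to_ncrat :: ('k, 'n) free_group_algebra \<Rightarrow> ('k, 'n) ncrat)"
proof (intro conjI universal_localization_free_algebra universal_localization_free_group_algebra)
  show "inj (fa_to_ncrat :: ('k, 'n) free_algebra \<Rightarrow> ('k, 'n) ncrat)"
    using inj_fa_to_nc by (auto intro!: injI dest!: arg_cong[of _ _ nc_of_rat] dest: injD)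
  show "inj (fga_to_ncrat :: ('k, 'n) free_group_algebra \<Rightarrow> ('k, 'n) ncrat)"
    using inj_fga_to_nc by (auto intro!: injI dest!: arg_cong[of _ _ nc_of_rat] dest: injD)
qed

end
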